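(* There exists a compact six-dimensional flat nearly para-Kähler manifold $(M,g,J)$ with $DJ\neq0$, where $D$ is the Levi-Civita connection of $g$.
   Context: A nearly para-Kähler manifold is a pseudo-Riemannian manifold $(M,g)$ with a $g$-skew-symmetric endomorphism field $J$ of $TM$ with $J^2=\mathrm{Id}$ such that the Levi-Civita connection $D$ satisfies $(D_XJ)X=0$ for all $X\in TM$. It is flat if the metric $g$ is flat. *)

theory Defs
  imports "HOL-Analysis.Analysis" "HOL-Library.Function_Algebras"
begin

text \<open>
  Smooth (\<open>C\<^sup>\<infinity>\<close>) maps on an open set \<open>S\<close>: all iterated directional derivatives
  exist and are continuous.
\<close>

primrec Ck_on :: "nat \<Rightarrow> 'e::euclidean_space set \<Rightarrow> ('e \<Rightarrow> 'f::euclidean_space) \<Rightarrow> bool" where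
  "Ck_on 0 S f \<longleftrightarrow> continuous_on S f"
| "Ck_on (Suc k) S f \<longleftrightarrow>
     (\<forall>x\<in>S. f differentiable (at x)) \<and>
     (\<forall>v. Ck_on k S (\<lambda>x. frechet_derivative f (at x) v))"

definition smooth_on :: "'e::euclidean_space set \<Rightarrow> ('e \<Rightarrow> 'f::euclidean_space) \<Rightarrow> bool" where
  "smooth_on S f \<longleftrightarrow> (\<forall>k. Ck_on k S f)"


subsection \<open>Smooth manifolds\<close>

text \<open>
  A chart is a pair of its domain and its coordinate map; the values of the coordinate map
  outside the domain are irrelevant.  A manifold is a topology \<open>M\<close> on a carrier set
  \<open>topspace M\<close>, together with a (not necessarily maximal) smooth atlas \<open>A\<close>.
\<close>

type_synonym ('a, 'e) chart = "'a set \<times> ('a \<Rightarrow> 'e)"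

abbreviation chart_dom :: "('a, 'e) chart \<Rightarrow> 'a set" where
  "chart_dom c \<equiv> fst c"

abbreviation chart_map :: "('a, 'e) chart \<Rightarrow> 'a \<Rightarrow> 'e" where
  "chart_map c \<equiv> snd c"

abbreviation chart_img :: "('a, 'e) chart \<Rightarrow> 'e set" where
  "chart_img c \<equiv> chart_map c ` chart_dom c"

abbreviation chart_inv :: "('a, 'e) chart \<Rightarrow> 'e \<Rightarrow> 'a" where
  "chart_inv c \<equiv> inv_into (chart_dom c) (chart_map c)"

definition is_chart :: "'a topology \<Rightarrow> ('a, 'e::euclidean_space) chart \<Rightarrow> bool" where
  "is_chart M c \<longleftrightarrow>
     openin M (chart_dom c) \<and> open (chart_img c) \<and>
     homeomorphic_map (subtopology M (chart_dom c)) (top_of_set (chart_img c)) (chart_map c)"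

definition transition ::
    "('a, 'e::euclidean_space) chart \<Rightarrow> ('a, 'e) chart \<Rightarrow> 'e \<Rightarrow> 'e" where
  "transition c c' = chart_map c' \<circ> chart_inv c"

definition smooth_manifold :: "'a topology \<Rightarrow> ('a, 'e::euclidean_space) chart set \<Rightarrow> bool" where
  "smooth_manifold M A \<longleftrightarrow>
     Hausdorff_space M \<and> second_countable M \<and>
     (\<forall>c\<in>A. is_chart M c) \<and> (\<Union>c\<in>A. chart_dom c) = topspace M \<and>
     (\<forall>c\<in>A. \<forall>c'\<in>A. smooth_on (chart_map c ` (chart_dom c \<inter> chart_dom c')) (transition c c'))"

definition smooth_function ::
    "('a, 'e::euclidean_space) chart set \<Rightarrow> ('a \<Rightarrow> real) \<Rightarrow> bool" where
  "smooth_function A f \<longleftrightarrow> (\<forall>c\<in>A. smooth_on (chart_img c) (f \<circ> chart_inv c))"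


subsection \<open>Tangent vectors and vector fields\<close>

text \<open>
  A tangent vector at \<open>p\<close> is the family of its coordinate vectors, one for every chart of the
  atlas around \<open>p\<close>, related by the differentials of the transition maps.  It is padded with
  \<open>0\<close> at all other indices, so that it is determined by these coordinate vectors.  Vector
  addition is the pointwise addition of functions.  At points that are not in the manifold, the
  tangent space is \<open>{0}\<close>.
\<close>

type_synonym ('a, 'e) tvec = "('a, 'e) chart \<Rightarrow> 'e"

definition tangent_space ::
    "('a, 'e::euclidean_space) chart set \<Rightarrow> 'a \<Rightarrow> ('a, 'e) tvec set" where
  "tangent_space A p =
     {v. (\<forall>c. c \<notin> A \<or> p \<notin> chart_dom c \<longrightarrow> v c = 0) \<and>
         (\<forall>c\<in>A. \<forall>c'\<in>A. p \<in> chart_dom c \<inter> chart_dom c' \<longrightarrow>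
            v c' = frechet_derivative (transition c c') (at (chart_map c p)) (v c))}"

definition tscale :: "real \<Rightarrow> ('a, 'e::euclidean_space) tvec \<Rightarrow> ('a, 'e) tvec" where
  "tscale a v = (\<lambda>c. a *\<^sub>R v c)"

text \<open>The tangent vector at \<open>p\<close> with coordinate vector \<open>e\<close> in the chart \<open>c\<close>.\<close>

definition coord_vec ::
    "('a, 'e::euclidean_space) chart set \<Rightarrow> ('a, 'e) chart \<Rightarrow> 'e \<Rightarrow> 'a \<Rightarrow> ('a, 'e) tvec" where
  "coord_vec A c e p =
     (\<lambda>c'. if c' \<in> A \<and> p \<in> chart_dom c'
           then frechet_derivative (transition c c') (at (chart_map c p)) e else 0)"

type_synonym ('a, 'e) vfield = "'a \<Rightarrow> ('a, 'e) tvec"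

definition vector_fields ::
    "('a, 'e::euclidean_space) chart set \<Rightarrow> ('a, 'e) vfield set" where
  "vector_fields A =
     {X. (\<forall>p. X p \<in> tangent_space A p) \<and>
         (\<forall>c\<in>A. smooth_on (chart_img c) (\<lambda>x. X (chart_inv c x) c))}"

definition fscale ::
    "('a \<Rightarrow> real) \<Rightarrow> ('a, 'e::euclidean_space) vfield \<Rightarrow> ('a, 'e) vfield" where
  "fscale f X = (\<lambda>p. tscale (f p) (X p))"

text \<open>
  The derivative \<open>X f\<close> of a function along a vector field.  By the chain rule, it does not
  depend on the chart that is used to compute it.
\<close>

definition vf_deriv ::
    "('a, 'e::euclidean_space) chart set \<Rightarrow> ('a, 'e) vfield \<Rightarrow> ('a \<Rightarrow> real) \<Rightarrow> 'a \<Rightarrow> real" where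
  "vf_deriv A X f p =
     (let c = (SOME c. c \<in> A \<and> p \<in> chart_dom c)
      in frechet_derivative (f \<circ> chart_inv c) (at (chart_map c p)) (X p c))"

definition lie_bracket ::
    "('a, 'e::euclidean_space) chart set \<Rightarrow> ('a, 'e) vfield \<Rightarrow> ('a, 'e) vfield \<Rightarrow> ('a, 'e) vfield"
  where
  "lie_bracket A X Y p c =
     (if c \<in> A \<and> p \<in> chart_dom c
      then frechet_derivative (\<lambda>x. Y (chart_inv c x) c) (at (chart_map c p)) (X p c)
         - frechet_derivative (\<lambda>x. X (chart_inv c x) c) (at (chart_map c p)) (Y p c)
      else 0)"


subsection \<open>Pseudo-Riemannian metrics and the Levi-Civita connection\<close>

type_synonym ('a, 'e) metric_field = "'a \<Rightarrow> ('a, 'e) tvec \<Rightarrow> ('a, 'e) tvec \<Rightarrow> real"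

definition pseudo_riemannian_metric ::
    "('a, 'e::euclidean_space) chart set \<Rightarrow> ('a, 'e) metric_field \<Rightarrow> bool" where
  "pseudo_riemannian_metric A g \<longleftrightarrow>
     (\<forall>p. \<forall>u\<in>tangent_space A p. \<forall>v\<in>tangent_space A p.
        g p u v = g p v u \<and>
        (\<forall>w\<in>tangent_space A p. g p (u + v) w = g p u w + g p v w) \<and>
        (\<forall>a. g p (tscale a u) v = a * g p u v)) \<and>
     (\<forall>p. \<forall>u\<in>tangent_space A p. (\<forall>v\<in>tangent_space A p. g p u v = 0) \<longrightarrow> u = 0) \<and>
     (\<forall>c\<in>A. \<forall>e e'. smooth_on (chart_img c)
        (\<lambda>x. let p = chart_inv c x in g p (coord_vec A c e p) (coord_vec A c e' p)))"

text \<open>Connections are only meaningful on smooth vector fields.\<close>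

type_synonym ('a, 'e) connection = "('a, 'e) vfield \<Rightarrow> ('a, 'e) vfield \<Rightarrow> ('a, 'e) vfield"

definition affine_connection ::
    "('a, 'e::euclidean_space) chart set \<Rightarrow> ('a, 'e) connection \<Rightarrow> bool" where
  "affine_connection A D \<longleftrightarrow>
     (\<forall>X\<in>vector_fields A. \<forall>Y\<in>vector_fields A.
        D X Y \<in> vector_fields A \<and>
        (\<forall>Z\<in>vector_fields A. D (X + Y) Z = D X Z + D Y Z \<and> D X (Y + Z) = D X Y + D X Z) \<and>
        (\<forall>f. smooth_function A f \<longrightarrow>
           D (fscale f X) Y = fscale f (D X Y) \<and>
           D X (fscale f Y) = fscale (vf_deriv A X f) Y + fscale f (D X Y)))"

definition levi_civita_connection ::
    "'a topology \<Rightarrow> ('a, 'e::euclidean_space) chart set \<Rightarrow> ('a, 'e) metric_field \<Rightarrow>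
     ('a, 'e) connection \<Rightarrow> bool" where
  "levi_civita_connection M A g D \<longleftrightarrow>
     affine_connection A D \<and>
     (\<forall>X\<in>vector_fields A. \<forall>Y\<in>vector_fields A. D X Y - D Y X = lie_bracket A X Y) \<and>
     (\<forall>X\<in>vector_fields A. \<forall>Y\<in>vector_fields A. \<forall>Z\<in>vector_fields A. \<forall>p\<in>topspace M.
        vf_deriv A X (\<lambda>q. g q (Y q) (Z q)) p = g p (D X Y p) (Z p) + g p (Y p) (D X Z p))"

definition curvature ::
    "('a, 'e::euclidean_space) chart set \<Rightarrow> ('a, 'e) connection \<Rightarrow>
     ('a, 'e) vfield \<Rightarrow> ('a, 'e) vfield \<Rightarrow> ('a, 'e) vfield \<Rightarrow> ('a, 'e) vfield" where
  "curvature A D X Y Z = D X (D Y Z) - D Y (D X Z) - D (lie_bracket A X Y) Z"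

text \<open>Flatness of a metric with Levi-Civita connection \<open>D\<close>: the curvature tensor vanishes.\<close>

definition flat :: "('a, 'e::euclidean_space) chart set \<Rightarrow> ('a, 'e) connection \<Rightarrow> bool" where
  "flat A D \<longleftrightarrow>
     (\<forall>X\<in>vector_fields A. \<forall>Y\<in>vector_fields A. \<forall>Z\<in>vector_fields A. curvature A D X Y Z = 0)"


subsection \<open>Nearly para-Kaehler manifolds\<close>

type_synonym ('a, 'e) endo_field = "'a \<Rightarrow> ('a, 'e) tvec \<Rightarrow> ('a, 'e) tvec"

definition endomorphism_field ::
    "('a, 'e::euclidean_space) chart set \<Rightarrow> ('a, 'e) endo_field \<Rightarrow> bool" where
  "endomorphism_field A J \<longleftrightarrow>
     (\<forall>p. \<forall>u\<in>tangent_space A p.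
        J p u \<in> tangent_space A p \<and>
        (\<forall>v\<in>tangent_space A p. J p (u + v) = J p u + J p v) \<and>
        (\<forall>a. J p (tscale a u) = tscale a (J p u))) \<and>
     (\<forall>c\<in>A. \<forall>e. smooth_on (chart_img c)
        (\<lambda>x. let p = chart_inv c x in J p (coord_vec A c e p) c))"

definition endo_apply ::
    "('a, 'e) endo_field \<Rightarrow> ('a, 'e) vfield \<Rightarrow> ('a, 'e) vfield" where
  "endo_apply J X = (\<lambda>p. J p (X p))"

text \<open>The covariant derivative \<open>(D\<^sub>X J) Y = D\<^sub>X (J Y) - J (D\<^sub>X Y)\<close>.\<close>

definition cov_deriv_endo ::
    "('a, 'e::euclidean_space) connection \<Rightarrow> ('a, 'e) endo_field \<Rightarrow>
     ('a, 'e) vfield \<Rightarrow> ('a, 'e) vfield \<Rightarrow> ('a, 'e) vfield" where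
  "cov_deriv_endo D J X Y = D X (endo_apply J Y) - endo_apply J (D X Y)"

text \<open>
  The Levi-Civita connection \<open>D\<close>, which is determined by \<open>g\<close>, is carried along as a parameter.
\<close>

definition nearly_para_kaehler ::
    "'a topology \<Rightarrow> ('a, 'e::euclidean_space) chart set \<Rightarrow> ('a, 'e) metric_field \<Rightarrow>
     ('a, 'e) endo_field \<Rightarrow> ('a, 'e) connection \<Rightarrow> bool" where
  "nearly_para_kaehler M A g J D \<longleftrightarrow>
     smooth_manifold M A \<and> pseudo_riemannian_metric A g \<and> levi_civita_connection M A g D \<and>
     endomorphism_field A J \<and>
     (\<forall>p. \<forall>u\<in>tangent_space A p. \<forall>v\<in>tangent_space A p. g p (J p u) v = - g p u (J p v)) \<and>
     (\<forall>p. \<forall>u\<in>tangent_space A p. J p (J p u) = u) \<and>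
     (\<forall>X\<in>vector_fields A. cov_deriv_endo D J X X = 0)"

end

theory Submission
  imports Defs
begin

text \<open>
  On \<open>\<real>\<^sup>6 = \<real>\<^sup>3 \<oplus> \<real>\<^sup>3\<close> with the neutral metric pairing the two null summands, let
  \<open>B (p, q) (p', q') = (q \<times> q', 0)\<close> and let \<open>S\<close> be \<open>1\<close> on the first and \<open>- 1\<close> on the second
  summand.  The maps \<open>y \<mapsto> y + n - B n y\<close> are isometries and form a two-step nilpotent group
  acting simply transitively; it preserves the para-complex structure \<open>J\<^sub>y w = S w + 2 B y w\<close>.
  The metric being flat, \<open>(D\<^sub>X J) Y = 2 B X Y\<close>, which is alternating and nonzero.  The integral
  vectors \<open>n\<close> form a lattice in the group, and the quotient by it is the required manifold.
\<close>

subsection \<open>Smooth maps\<close>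

text \<open>Pairing \<open>B x y\<close> with \<open>z\<close> gives the triple product of the
  second components, an alternating three-form. So every linear map \<open>B n\<close> is skew for
  the metric, products of two such maps vanish, and \<open>1 - B n\<close> is an isometry. The
  obstacle to a compact quotient is that \<open>J\<close> varies with the base point: a translation
  by \<open>n\<close> changes it by \<open>2 B n\<close>. The linear part \<open>1 - B n\<close> of
  the action repairs this. Since \<open>B\<close> takes values where \<open>S = 1\<close> and
  vanishes there, \<open>S B n - B n S = 2 B n\<close>, so conjugating \<open>S\<close> by
  \<open>1 - B n\<close> adds exactly \<open>2 B n\<close>. This explains both the factor 2 in
  \<open>J\<close> and the twist in the action. The definitions speak of charts, but every chart is
  a local inverse of the projection from the covering space. Smooth vector fields on the quotient
  are therefore identified with smooth maps of the covering that are equivariant under the lattice,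
  and all conditions are checked there with ordinary derivatives.\<close>

lemma Ck_on_cong:
  assumes "open S" "\<And>x. x \<in> S \<Longrightarrow> f x = g x" "Ck_on k S f"
  shows "Ck_on k S g"
  using assms(2,3)
proof (induction k arbitrary: f g)
  case 0
  then show ?case by (metis Ck_on.simps(1) continuous_on_cong)
next
  case (Suc k)
  have d: "f differentiable (at x)" if "x \<in> S" for x
    using Suc.prems that by simp
  have "g differentiable (at x)" if "x \<in> S" for x
    using d[OF that] that assms(1) Suc.prems(1)
    by (meson differentiable_def has_derivative_transform_within_open)
  moreover have eq: "frechet_derivative f (at x) = frechet_derivative g (at x)" if "x \<in> S" for x
    using d[OF that] assms(1) that Suc.prems(1) by (rule frechet_derivative_transform_within_open)
  have "Ck_on k S (\<lambda>x. frechet_derivative g (at x) v)" for v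
    by (rule Suc.IH[of "\<lambda>x. frechet_derivative f (at x) v"])
      (use eq Suc.prems(2) in simp_all)
  ultimately show ?case by simp
qed

lemma Ck_on_subset:
  assumes "Ck_on k S f" "T \<subseteq> S"
  shows "Ck_on k T f"
  using assms by (induction k arbitrary: f) (auto intro: continuous_on_subset)

lemma Ck_on_local:
  assumes "\<And>x. x \<in> S \<Longrightarrow> \<exists>T. open T \<and> x \<in> T \<and> Ck_on k T f"
  shows "Ck_on k S f"
  using assms
proof (induction k arbitrary: f)
  case 0
  have "isCont f x" if "x \<in> S" for x
    using 0[OF that] by (auto simp: continuous_on_eq_continuous_at)
  then show ?case by (simp add: continuous_at_imp_continuous_on)
next
  case (Suc k)
  have "f differentiable (at x)" if "x \<in> S" for x
    using Suc.prems[OF that] by auto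
  moreover have "Ck_on k S (\<lambda>x. frechet_derivative f (at x) v)" for v
    using Suc.prems by (intro Suc.IH) fastforce
  ultimately show ?case by simp
qed

lemma Ck_on_Suc_imp:
  assumes "Ck_on (Suc k) S f"
  shows "Ck_on k S f"
  using assms
proof (induction k arbitrary: f)
  case 0
  then show ?case
    by (auto intro!: continuous_at_imp_continuous_on differentiable_imp_continuous_within)
next
  case (Suc k)
  then show ?case by (metis Ck_on.simps(2))
qed

lemma Ck_on_const: "Ck_on k S (\<lambda>x. c)"
  by (induction k arbitrary: c) auto

lemma Ck_on_bounded_linear:
  assumes "bounded_linear L"
  shows "Ck_on k S L"
proof (cases k)
  case 0
  then show ?thesis using assms by (simp add: linear_continuous_on)
next
  case (Suc j)
  have "frechet_derivative L (at x) = L" for x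
    using assms by (metis bounded_linear_imp_has_derivative frechet_derivative_at)
  moreover have "L differentiable (at x)" for x
    using assms by (rule bounded_linear_imp_differentiable)
  ultimately show ?thesis by (simp add: Suc Ck_on_const)
qed

lemma Ck_on_add:
  assumes "open S" "Ck_on k S f" "Ck_on k S g"
  shows "Ck_on k S (\<lambda>x. f x + g x)"
  using assms(2,3)
proof (induction k arbitrary: f g)
  case 0
  then show ?case by (simp add: continuous_on_add)
next
  case (Suc k)
  have "Ck_on k S (\<lambda>x. frechet_derivative (\<lambda>x. f x + g x) (at x) v)" for v
  proof (rule Ck_on_cong[OF assms(1)])
    show "Ck_on k S (\<lambda>x. frechet_derivative f (at x) v + frechet_derivative g (at x) v)"
      using Suc by simp
    show "frechet_derivative f (at x) v + frechet_derivative g (at x) v =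
        frechet_derivative (\<lambda>x. f x + g x) (at x) v" if "x \<in> S" for x
    proof -
      have "((\<lambda>x. f x + g x) has_derivative
          (\<lambda>v. frechet_derivative f (at x) v + frechet_derivative g (at x) v)) (at x)"
        using Suc.prems that
        by (intro has_derivative_add) (auto simp flip: frechet_derivative_works)
      then show ?thesis by (rule fun_cong[OF frechet_derivative_at])
    qed
  qed
  then show ?case using Suc.prems by simp
qed

text \<open>The product rule turns the derivative into a sum of two products of the same kind. Each
  keeps one undifferentiated factor, which enters the induction one order below its known
  regularity.\<close>

lemma Ck_on_bilinear:
  fixes P :: "'b::euclidean_space \<Rightarrow> 'c::euclidean_space \<Rightarrow> 'd::euclidean_space"
  assumes P: "bounded_bilinear P" and "open S" "Ck_on k S f" "Ck_on k S g"
  shows "Ck_on k S (\<lambda>x. P (f x) (g x))"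
  using assms(3,4)
proof (induction k arbitrary: f g)
  case 0
  then show ?case using bounded_bilinear.continuous_on[OF P] by simp
next
  case (Suc k)
  have der: "((\<lambda>x. P (f x) (g x)) has_derivative
      (\<lambda>v. P (f x) (frechet_derivative g (at x) v) + P (frechet_derivative f (at x) v) (g x))) (at x)"
    if "x \<in> S" for x
    using Suc.prems that
    by (intro bounded_bilinear.FDERIV[OF P]) (auto simp flip: frechet_derivative_works)
  have "Ck_on k S (\<lambda>x. frechet_derivative (\<lambda>x. P (f x) (g x)) (at x) v)" for v
  proof (rule Ck_on_cong[OF assms(2)])
    show "Ck_on k S (\<lambda>x. P (f x) (frechet_derivative g (at x) v) + P (frechet_derivative f (at x) v) (g x))"
      using Suc.prems Ck_on_Suc_imp[of k S f] Ck_on_Suc_imp[of k S g]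
      by (intro Ck_on_add[OF assms(2)] Suc.IH) auto
  qed (rule fun_cong[OF frechet_derivative_at[OF der]])
  moreover have "(\<lambda>x. P (f x) (g x)) differentiable (at x)" if "x \<in> S" for x
    using der[OF that] by (auto simp: differentiable_def)
  ultimately show ?case by simp
qed

lemma Ck_on_sum:
  assumes "open S" "\<And>i. i \<in> I \<Longrightarrow> Ck_on k S (f i)"
  shows "Ck_on k S (\<lambda>x. \<Sum>i\<in>I. f i x)"
  using assms(2)
  by (induction I rule: infinite_finite_induct) (auto intro: Ck_on_const Ck_on_add[OF assms(1)])

lemma smooth_on_cong:
  "open S \<Longrightarrow> (\<And>x. x \<in> S \<Longrightarrow> f x = g x) \<Longrightarrow> smooth_on S f \<Longrightarrow> smooth_on S g"
  unfolding smooth_on_def using Ck_on_cong by blast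

lemma smooth_on_subset: "smooth_on S f \<Longrightarrow> T \<subseteq> S \<Longrightarrow> smooth_on T f"
  unfolding smooth_on_def using Ck_on_subset by blast

lemma smooth_on_local:
  "(\<And>x. x \<in> S \<Longrightarrow> \<exists>T. open T \<and> x \<in> T \<and> smooth_on T f) \<Longrightarrow> smooth_on S f"
  unfolding smooth_on_def by (metis Ck_on_local)

lemma smooth_on_const: "smooth_on S (\<lambda>x. c)"
  by (simp add: smooth_on_def Ck_on_const)

lemma smooth_on_bounded_linear: "bounded_linear L \<Longrightarrow> smooth_on S L"
  by (simp add: smooth_on_def Ck_on_bounded_linear)

lemma smooth_on_add:
  "open S \<Longrightarrow> smooth_on S f \<Longrightarrow> smooth_on S g \<Longrightarrow> smooth_on S (\<lambda>x. f x + g x)"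
  by (simp add: smooth_on_def Ck_on_add)

lemma smooth_on_bilinear:
  fixes P :: "'b::euclidean_space \<Rightarrow> 'c::euclidean_space \<Rightarrow> 'd::euclidean_space"
  assumes "bounded_bilinear P" "open S" "smooth_on S f" "smooth_on S g"
  shows "smooth_on S (\<lambda>x. P (f x) (g x))"
  using assms by (simp add: smooth_on_def Ck_on_bilinear)

lemma smooth_on_imp_differentiable: "smooth_on S f \<Longrightarrow> x \<in> S \<Longrightarrow> f differentiable (at x)"
  unfolding smooth_on_def using Ck_on.simps(2) by blast

lemma smooth_on_imp_has_derivative:
  "smooth_on S f \<Longrightarrow> x \<in> S \<Longrightarrow> (f has_derivative frechet_derivative f (at x)) (at x)"
  using smooth_on_imp_differentiable frechet_derivative_works by blast

lemma smooth_on_imp_continuous_on: "smooth_on S f \<Longrightarrow> continuous_on S f"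
  unfolding smooth_on_def using Ck_on.simps(1) by blast

lemma smooth_on_frechet_derivative_const:
  "smooth_on S f \<Longrightarrow> smooth_on S (\<lambda>x. frechet_derivative f (at x) v)"
  unfolding smooth_on_def by (metis Ck_on.simps(2))

text \<open>Smoothness as defined only concerns fixed directions; expanding the moving direction
  \<open>V x\<close> in the basis reduces to these.\<close>

lemma smooth_on_frechet_derivative:
  fixes f :: "'a::euclidean_space \<Rightarrow> 'b::euclidean_space"
  assumes "open S" "smooth_on S f" "smooth_on S V"
  shows "smooth_on S (\<lambda>x. frechet_derivative f (at x) (V x))"
proof (rule smooth_on_cong[OF assms(1)])
  show "smooth_on S (\<lambda>x. \<Sum>i\<in>Basis. (V x \<bullet> i) *\<^sub>R frechet_derivative f (at x) i)"
    unfolding smooth_on_def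
  proof (intro allI Ck_on_sum[OF assms(1)])
    fix k i
    have "smooth_on S (\<lambda>x. (V x \<bullet> i) *\<^sub>R frechet_derivative f (at x) i)"
      using assms
      by (intro smooth_on_bilinear[OF bounded_bilinear_scaleR] smooth_on_bilinear[OF bounded_bilinear_inner]
            smooth_on_frechet_derivative_const smooth_on_const)
    then show "Ck_on k S (\<lambda>x. (V x \<bullet> i) *\<^sub>R frechet_derivative f (at x) i)"
      by (simp add: smooth_on_def)
  qed
next
  fix x assume "x \<in> S"
  then have "linear (frechet_derivative f (at x))"
    using assms(2) smooth_on_imp_differentiable linear_frechet_derivative by blast
  then have "(\<Sum>i\<in>Basis. (V x \<bullet> i) *\<^sub>R frechet_derivative f (at x) i) =
      frechet_derivative f (at x) (\<Sum>i\<in>Basis. (V x \<bullet> i) *\<^sub>R i)"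
    by (simp add: linear_sum linear_cmul)
  then show "(\<Sum>i\<in>Basis. (V x \<bullet> i) *\<^sub>R frechet_derivative f (at x) i) =
      frechet_derivative f (at x) (V x)"
    by (simp add: euclidean_representation)
qed

section \<open>Symmetry of second derivatives\<close>

lemma has_real_derivative_along_line:
  fixes h :: "'a::euclidean_space \<Rightarrow> real"
  assumes "h differentiable (at (x + t *\<^sub>R u))"
  shows "((\<lambda>t. h (x + t *\<^sub>R u)) has_real_derivative frechet_derivative h (at (x + t *\<^sub>R u)) u) (at t)"
proof -
  let ?D = "frechet_derivative h (at (x + t *\<^sub>R u))"
  have "((\<lambda>t. x + t *\<^sub>R u) has_derivative (\<lambda>s. s *\<^sub>R u)) (at t)"
    by (auto intro!: derivative_eq_intros)
  moreover have "(h has_derivative ?D) (at (x + t *\<^sub>R u))"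
    using assms by (simp flip: frechet_derivative_works)
  ultimately have "((\<lambda>t. h (x + t *\<^sub>R u)) has_derivative (\<lambda>s. ?D (s *\<^sub>R u))) (at t)"
    by (rule has_derivative_compose)
  moreover have "?D (s *\<^sub>R u) = ?D u * s" for s
    using linear_frechet_derivative[OF assms] by (simp add: linear_cmul)
  ultimately show ?thesis by (simp add: has_field_derivative_def)
qed

text \<open>The mean value theorem is used twice: in the direction \<open>u\<close> for the
  difference of two parallel copies of \<open>h\<close>, which yields \<open>a\<close>, and then in
  the direction \<open>v\<close> for the derivative along \<open>u\<close>, which yields
  \<open>b\<close>.\<close>

lemma second_difference_mvt:
  fixes h :: "'a::euclidean_space \<Rightarrow> real"
  assumes h: "\<And>y. h differentiable (at y)"
    and hu: "\<And>y. (\<lambda>y. frechet_derivative h (at y) u) differentiable (at y)" and s: "s > 0"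
  shows "\<exists>a b. a \<in> {0..s} \<and> b \<in> {0..s} \<and>
    h (x + s *\<^sub>R u + s *\<^sub>R v) - h (x + s *\<^sub>R u) - h (x + s *\<^sub>R v) + h x =
    s\<^sup>2 * frechet_derivative (\<lambda>y. frechet_derivative h (at y) u) (at (x + a *\<^sub>R u + b *\<^sub>R v)) v"
proof -
  let ?hu = "\<lambda>y. frechet_derivative h (at y) u"
  have "\<exists>a>0. a < s \<and> (h (x + s *\<^sub>R v + s *\<^sub>R u) - h (x + s *\<^sub>R u))
      - (h (x + s *\<^sub>R v + 0 *\<^sub>R u) - h (x + 0 *\<^sub>R u))
      = (s - 0) * (?hu (x + s *\<^sub>R v + a *\<^sub>R u) - ?hu (x + a *\<^sub>R u))"
    using s by (intro MVT2 DERIV_diff has_real_derivative_along_line h)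
  then obtain a where a: "0 < a" "a < s"
    "h (x + s *\<^sub>R u + s *\<^sub>R v) - h (x + s *\<^sub>R u) - h (x + s *\<^sub>R v) + h x =
      s * (?hu (x + a *\<^sub>R u + s *\<^sub>R v) - ?hu (x + a *\<^sub>R u))"
    by (auto simp: algebra_simps)
  have "\<exists>b>0. b < s \<and> ?hu (x + a *\<^sub>R u + s *\<^sub>R v) - ?hu (x + a *\<^sub>R u + 0 *\<^sub>R v)
      = (s - 0) * frechet_derivative ?hu (at (x + a *\<^sub>R u + b *\<^sub>R v)) v"
    using s by (intro MVT2 has_real_derivative_along_line hu)
  then obtain b where "0 < b" "b < s" "?hu (x + a *\<^sub>R u + s *\<^sub>R v) - ?hu (x + a *\<^sub>R u)
      = s * frechet_derivative ?hu (at (x + a *\<^sub>R u + b *\<^sub>R v)) v"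
    by auto
  with a show ?thesis
    by (intro exI[of _ a] exI[of _ b]) (auto simp: power2_eq_square)
qed

text \<open>The second difference quotient \<open>?Q u v\<close> is symmetric in \<open>u\<close>
  and \<open>v\<close>. By \<open>second_difference_mvt\<close> it is a value of the mixed
  derivative at a point tending to \<open>x\<close>, so continuity gives both orders of
  differentiation as limits of the same sequence.\<close>

lemma second_derivative_symmetric_real:
  fixes h :: "'a::euclidean_space \<Rightarrow> real"
  assumes h: "smooth_on UNIV h"
  shows "frechet_derivative (\<lambda>y. frechet_derivative h (at y) u) (at x) v =
    frechet_derivative (\<lambda>y. frechet_derivative h (at y) v) (at x) u"
proof -
  let ?H = "\<lambda>u v y. frechet_derivative (\<lambda>y. frechet_derivative h (at y) u) (at y) v"
  have d: "h differentiable (at y)" "(\<lambda>y. frechet_derivative h (at y) w) differentiable (at y)" for y w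
    using h by (auto intro: smooth_on_imp_differentiable smooth_on_frechet_derivative_const)
  have cont: "isCont (?H u v) x" for u v
    using smooth_on_imp_continuous_on[OF
        smooth_on_frechet_derivative_const[OF smooth_on_frechet_derivative_const[OF h]]]
    by (simp add: continuous_on_eq_continuous_at)
  define s :: "nat \<Rightarrow> real" where "s n = inverse (real (Suc n))" for n
  have s: "s n > 0" for n by (simp add: s_def)
  have s0: "s \<longlonglongrightarrow> 0"
    unfolding s_def by (rule LIMSEQ_inverse_real_of_nat)
  let ?Q = "\<lambda>u v n. (h (x + s n *\<^sub>R u + s n *\<^sub>R v) - h (x + s n *\<^sub>R u) - h (x + s n *\<^sub>R v) + h x) / (s n)\<^sup>2"
  have lim: "?Q u v \<longlonglongrightarrow> ?H u v x" for u v
  proof -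
    have "\<exists>y. norm (y - x) \<le> s n * (norm u + norm v) \<and> ?Q u v n = ?H u v y" for n
    proof -
      obtain a b where ab: "a \<in> {0..s n}" "b \<in> {0..s n}"
        "h (x + s n *\<^sub>R u + s n *\<^sub>R v) - h (x + s n *\<^sub>R u) - h (x + s n *\<^sub>R v) + h x =
          (s n)\<^sup>2 * ?H u v (x + a *\<^sub>R u + b *\<^sub>R v)"
        using second_difference_mvt[where h = h and u = u and v = v and x = x, OF d s] by blast
      have "norm (a *\<^sub>R u + b *\<^sub>R v) \<le> s n * norm u + s n * norm v"
        using ab(1,2) by (intro norm_triangle_mono) (auto intro: mult_right_mono)
      then show ?thesis
        using ab(3) s[of n]
        by (intro exI[of _ "x + a *\<^sub>R u + b *\<^sub>R v"]) (simp add: algebra_simps)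
    qed
    then have "\<exists>y. \<forall>n. norm (y n - x) \<le> s n * (norm u + norm v) \<and> ?Q u v n = ?H u v (y n)"
      by (intro choice allI)
    then obtain y where y: "\<And>n. norm (y n - x) \<le> s n * (norm u + norm v)"
      "\<And>n. ?Q u v n = ?H u v (y n)"
      by blast
    have "(\<lambda>n. s n * (norm u + norm v)) \<longlonglongrightarrow> 0"
      using tendsto_mult_left_zero[OF s0] .
    then have "(\<lambda>n. y n - x) \<longlonglongrightarrow> 0"
      by (rule Lim_null_comparison[OF always_eventually[OF allI[OF y(1)]]])
    then have "y \<longlonglongrightarrow> x" by (simp add: LIM_zero_iff)
    then have "(\<lambda>n. ?H u v (y n)) \<longlonglongrightarrow> ?H u v x"
      using cont by (rule isCont_tendsto_compose[rotated])
    then show ?thesis by (simp only: y(2))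
  qed
  have "?Q u v = ?Q v u"
    by (intro ext) (simp add: algebra_simps)
  then have "?Q u v \<longlonglongrightarrow> ?H v u x"
    using lim[of v u] by simp
  then show ?thesis using lim[of u v] LIMSEQ_unique by blast
qed

lemma frechet_derivative_bounded_linear_comp:
  assumes "bounded_linear L" "f differentiable (at x)"
  shows "frechet_derivative (\<lambda>x. L (f x)) (at x) v = L (frechet_derivative f (at x) v)"
proof -
  have "((\<lambda>x. L (f x)) has_derivative (\<lambda>v. L (frechet_derivative f (at x) v))) (at x)"
    using assms(2) by (intro bounded_linear.has_derivative[OF assms(1)] iffD1[OF frechet_derivative_works])
  from fun_cong[OF frechet_derivative_at[OF this], of v] show ?thesis by simp
qed

lemma second_derivative_symmetric:
  fixes f :: "'a::euclidean_space \<Rightarrow> 'b::euclidean_space"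
  assumes f: "smooth_on UNIV f"
  shows "frechet_derivative (\<lambda>y. frechet_derivative f (at y) u) (at x) v =
    frechet_derivative (\<lambda>y. frechet_derivative f (at y) v) (at x) u"
proof (rule euclidean_eqI)
  fix i :: 'b
  have bl: "bounded_linear (\<lambda>z. z \<bullet> i)" by (rule bounded_linear_inner_left)
  have "smooth_on UNIV (\<lambda>x. f x \<bullet> i)"
    using f by (intro smooth_on_bilinear[OF bounded_bilinear_inner] smooth_on_const) auto
  note sym = second_derivative_symmetric_real[OF this, of u x v]
  have d: "f differentiable (at y)" "(\<lambda>y. frechet_derivative f (at y) w) differentiable (at y)" for y w
    using f by (auto intro: smooth_on_imp_differentiable smooth_on_frechet_derivative_const)
  show "frechet_derivative (\<lambda>y. frechet_derivative f (at y) u) (at x) v \<bullet> i =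
    frechet_derivative (\<lambda>y. frechet_derivative f (at y) v) (at x) u \<bullet> i"
    using sym by (simp add: frechet_derivative_bounded_linear_comp[OF bl] d)
qed

text \<open>Product rule for a derivative applied to a moving vector. The basis expansion separates
  the scalar coefficients of \<open>V\<close> from derivatives in fixed directions; the first
  summand on the right has the direction frozen at \<open>V x\<close>, so it is a genuine second
  derivative.\<close>

lemma frechet_derivative_along_field:
  fixes f :: "'a::euclidean_space \<Rightarrow> 'b::euclidean_space"
  assumes f: "smooth_on UNIV f" and V: "smooth_on UNIV V"
  shows "frechet_derivative (\<lambda>y. frechet_derivative f (at y) (V y)) (at x) v =
    frechet_derivative (\<lambda>y. frechet_derivative f (at y) (V x)) (at x) v
    + frechet_derivative f (at x) (frechet_derivative V (at x) v)"
proof -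
  have lin: "linear (frechet_derivative f (at y))" for y
    using f by (auto intro: smooth_on_imp_differentiable linear_frechet_derivative)
  have rep: "(\<Sum>i\<in>Basis. (w \<bullet> i) *\<^sub>R frechet_derivative f (at y) i) = frechet_derivative f (at y) w" for y w
    using linear_sum[OF lin[of y], of "\<lambda>i. (w \<bullet> i) *\<^sub>R i" Basis] 
    by (simp add: linear_cmul[OF lin] euclidean_representation)
  have d: "((\<lambda>y. frechet_derivative f (at y) i) has_derivative
      frechet_derivative (\<lambda>y. frechet_derivative f (at y) i) (at x)) (at x)" for i
    using f by (auto intro: smooth_on_imp_has_derivative smooth_on_frechet_derivative_const)
  have dV: "(V has_derivative frechet_derivative V (at x)) (at x)"
    using V by (auto intro: smooth_on_imp_has_derivative)
  have 1: "((\<lambda>y. \<Sum>i\<in>Basis. (w \<bullet> i) *\<^sub>R frechet_derivative f (at y) i) has_derivative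
    (\<lambda>v. \<Sum>i\<in>Basis. (w \<bullet> i) *\<^sub>R frechet_derivative (\<lambda>y. frechet_derivative f (at y) i) (at x) v)) (at x)" for w
    by (intro has_derivative_sum has_derivative_scaleR_right d)
  have 2: "((\<lambda>y. \<Sum>i\<in>Basis. (V y \<bullet> i) *\<^sub>R frechet_derivative f (at y) i) has_derivative
    (\<lambda>v. \<Sum>i\<in>Basis. (V x \<bullet> i) *\<^sub>R frechet_derivative (\<lambda>y. frechet_derivative f (at y) i) (at x) v
        + (frechet_derivative V (at x) v \<bullet> i) *\<^sub>R frechet_derivative f (at x) i)) (at x)"
    by (intro has_derivative_sum has_derivative_scaleR has_derivative_inner_left d dV)
  show ?thesis
    using fun_cong[OF frechet_derivative_at[OF 1[of "V x"]], of v] fun_cong[OF frechet_derivative_at[OF 2], of v]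
    by (simp add: rep sum.distrib)
qed

lemma frechet_derivative_add:
  fixes f g :: "'a::euclidean_space \<Rightarrow> 'b::euclidean_space"
  assumes "smooth_on UNIV f" "smooth_on UNIV g"
  shows "frechet_derivative (\<lambda>y. f y + g y) (at x) v =
    frechet_derivative f (at x) v + frechet_derivative g (at x) v"
proof -
  have "((\<lambda>y. f y + g y) has_derivative
      (\<lambda>v. frechet_derivative f (at x) v + frechet_derivative g (at x) v)) (at x)"
    by (intro has_derivative_add smooth_on_imp_has_derivative[OF assms(1)]
        smooth_on_imp_has_derivative[OF assms(2)]) auto
  from fun_cong[OF frechet_derivative_at[OF this], of v] show ?thesis by simp
qed

lemma frechet_derivative_bilinear:
  fixes P :: "'a::euclidean_space \<Rightarrow> 'b::euclidean_space \<Rightarrow> 'c::euclidean_space"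
    and f :: "'d::euclidean_space \<Rightarrow> 'a"
  assumes "bounded_bilinear P" "smooth_on UNIV f" "smooth_on UNIV g"
  shows "frechet_derivative (\<lambda>y. P (f y) (g y)) (at x) v =
    P (f x) (frechet_derivative g (at x) v) + P (frechet_derivative f (at x) v) (g x)"
proof -
  have "((\<lambda>y. P (f y) (g y)) has_derivative
      (\<lambda>v. P (f x) (frechet_derivative g (at x) v) + P (frechet_derivative f (at x) v) (g x))) (at x)"
    by (intro bounded_bilinear.FDERIV[OF assms(1)] smooth_on_imp_has_derivative[OF assms(2)]
        smooth_on_imp_has_derivative[OF assms(3)]) auto
  from fun_cong[OF frechet_derivative_at[OF this], of v] show ?thesis by simp
qed

lemma linear_frechet_smooth: "smooth_on UNIV W \<Longrightarrow> linear (frechet_derivative W (at y))"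
  by (intro linear_frechet_derivative smooth_on_imp_differentiable[of UNIV]) auto

subsection \<open>Quotients by lattices in two-step nilpotent groups\<close>

text \<open>\<open>B\<close> plays the role of a two-step nilpotent Lie bracket. The closure
  conditions make \<open>L\<close> an additive group and also a group for the product
  \<open>m + n - B m n\<close>. The additive structure turns \<open>L_discrete\<close>, a gap at 0,
  into a uniform gap between elements of \<open>L\<close>.\<close>

locale nil_lattice =
  fixes B :: "'e::euclidean_space \<Rightarrow> 'e \<Rightarrow> 'e" and L :: "'e set"
  assumes bilinear: "bounded_bilinear B"
    and B_self [simp]: "B x x = 0"
    and B_B_left [simp]: "B (B x y) z = 0"
    and L_zero: "0 \<in> L"
    and L_add: "m \<in> L \<Longrightarrow> n \<in> L \<Longrightarrow> m + n \<in> L"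
    and L_minus: "n \<in> L \<Longrightarrow> - n \<in> L"
    and L_B: "m \<in> L \<Longrightarrow> n \<in> L \<Longrightarrow> B m n \<in> L"
    and L_discrete: "\<exists>e>0. \<forall>n\<in>L. norm n < e \<longrightarrow> n = 0"
begin

sublocale B: bounded_bilinear B
  by (rule bilinear)

lemmas B_simps = B.add_left B.add_right B.diff_left B.diff_right B.minus_left B.minus_right
  B.zero_left B.zero_right

lemma B_antisym: "B x y = - B y x"
proof -
  have "B x y + B y x = B (x + y) (x + y)"
    unfolding B.add_left B.add_right by simp
  then show ?thesis by (simp add: eq_neg_iff_add_eq_0)
qed

lemma B_B_right [simp]: "B z (B x y) = 0"
  by (subst B_antisym) simp

section \<open>The affine action and its orbits\<close>

definition act :: "'e \<Rightarrow> 'e \<Rightarrow> 'e" where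
  "act n y = y + n - B n y"

definition displacement :: "'e \<Rightarrow> 'e \<Rightarrow> 'e" where
  "displacement y z = z - y + B z y"

definition proj :: "'e \<Rightarrow> 'e set" where
  "proj y = (\<lambda>n. act n y) ` L"

text \<open>Simple transitivity. Applying \<open>B\<close> with second argument \<open>y\<close> to
  \<open>y + n - B n y = z\<close> gives \<open>B n y = B z y\<close>, because \<open>B y y\<close>
  and double brackets vanish; this determines \<open>n\<close>.\<close>

lemma act_eq_iff: "act n y = z \<longleftrightarrow> n = displacement y z"
  by (auto simp: act_def displacement_def B_simps)

lemma act_0 [simp]: "act 0 y = y"
  by (simp add: act_def B_simps)

text \<open>The group law: the twist of \<open>m\<close> sees \<open>n\<close> through
  \<open>- B m n\<close>, and all other new terms are double brackets.\<close>

lemma act_act: "act m (act n y) = act (m + n - B m n) y"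
  by (simp add: act_def B_simps algebra_simps)

lemma act_minus: "act (- n) (act n y) = y"
  by (simp add: act_act) (simp add: act_def B_simps)

lemma proj_act:
  assumes "n \<in> L"
  shows "proj (act n y) = proj y"
proof -
  have sub: "proj (act n y) \<subseteq> proj y" if "n \<in> L" for n y
  proof
    fix x assume "x \<in> proj (act n y)"
    then obtain m where "m \<in> L" "x = act m (act n y)" by (auto simp: proj_def)
    moreover have "m + n - B m n \<in> L" if "m \<in> L" for m
      using that \<open>n \<in> L\<close> L_add[of "m + n" "- B m n"] by (simp add: L_add L_minus L_B)
    ultimately show "x \<in> proj y" by (auto simp: proj_def act_act)
  qed
  from sub[OF L_minus[OF assms], of "act n y"] sub[OF assms, of y] show ?thesis
    by (simp add: act_minus)
qed

lemma proj_eq_iff: "proj y = proj z \<longleftrightarrow> displacement y z \<in> L"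
proof
  assume "proj y = proj z"
  moreover have "z \<in> proj z" using L_zero unfolding proj_def by (metis act_0 imageI)
  ultimately have "z \<in> proj y" by simp
  then obtain n where "n \<in> L" "act n y = z" by (auto simp: proj_def)
  then show "displacement y z \<in> L" by (simp add: act_eq_iff)
next
  assume "displacement y z \<in> L"
  from proj_act[OF this] show "proj y = proj z" by (metis act_eq_iff)
qed

lemma continuous_act: "continuous_on S (act n)"
  unfolding act_def by (intro continuous_intros B.continuous_on)

text \<open>Differences of elements of \<open>L\<close> lie in \<open>L\<close>, so distinct
  elements are at distance at least \<open>e\<close>. Closedness is what separates orbits in
  \<open>Hausdorff_quotient\<close>.\<close>

lemma closed_L: "closed L"
proof -
  obtain e where e: "e > 0" "\<And>n. n \<in> L \<Longrightarrow> norm n < e \<Longrightarrow> n = 0" using L_discrete by blast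
  have "y = x" if "x \<in> L" "y \<in> L" "dist y x < e" for x y
    using e(2)[of "y - x"] that L_add[of y "- x"] L_minus[of x] by (simp add: dist_norm)
  then show ?thesis using discrete_imp_closed[OF e(1)] by blast
qed

lemma continuous_displacement: "continuous_on S (\<lambda>p. displacement (fst p) (snd p))"
  unfolding displacement_def
  by (rule continuous_on_add continuous_on_diff B.continuous_on continuous_on_fst continuous_on_snd
      continuous_on_id)+

section \<open>The quotient topology\<close>

definition quotient :: "'e set topology" where
  "quotient = topology (\<lambda>U. U \<subseteq> range proj \<and> open (proj -` U))"

lemma openin_quotient: "openin quotient U \<longleftrightarrow> U \<subseteq> range proj \<and> open (proj -` U)"
proof -
  have "istopology (\<lambda>U. U \<subseteq> range proj \<and> open (proj -` U))"
    by (auto simp: istopology_def vimage_Union)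
  then show ?thesis by (simp add: quotient_def topology_inverse')
qed

lemma topspace_quotient: "topspace quotient = range proj"
proof
  show "topspace quotient \<subseteq> range proj"
    using openin_topspace[of quotient] by (simp only: openin_quotient)
  have "proj -` range proj = UNIV" by auto
  then have "openin quotient (range proj)" by (simp add: openin_quotient)
  then show "range proj \<subseteq> topspace quotient" by (rule openin_subset)
qed

text \<open>The saturation of \<open>U\<close> is the union of its preimages under the
  homeomorphisms \<open>act n\<close>, hence open.\<close>

lemma openin_proj_image:
  assumes "open U"
  shows "openin quotient (proj ` U)"
proof -
  have "proj -` proj ` U = (\<Union>n\<in>L. act n -` U)"
  proof (intro set_eqI iffI)
    fix y assume "y \<in> proj -` proj ` U"
    then obtain z where z: "z \<in> U" "proj y = proj z" by auto
    then have "displacement y z \<in> L" "act (displacement y z) y = z"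
      by (auto simp: proj_eq_iff act_eq_iff)
    then show "y \<in> (\<Union>n\<in>L. act n -` U)" using z(1) by force
  next
    fix y assume "y \<in> (\<Union>n\<in>L. act n -` U)"
    then obtain n where "n \<in> L" "act n y \<in> U" by auto
    then show "y \<in> proj -` proj ` U" using proj_act by (metis imageI vimage_eq)
  qed
  moreover have "open (act n -` U)" for n
    using assms continuous_act open_vimage by blast
  ultimately show ?thesis by (auto simp: openin_quotient)
qed

lemma continuous_map_proj: "continuous_map euclidean quotient proj"
  by (auto simp: continuous_map_def openin_quotient topspace_quotient vimage_def)

lemma open_map_proj: "open_map euclidean quotient proj"
  by (simp add: open_map_def openin_proj_image)

lemma second_countable_quotient: "second_countable quotient"
proof (rule second_countable_open_map_image[OF continuous_map_proj open_map_proj])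
  show "second_countable (euclidean :: 'e topology)"
  proof -
    obtain \<B> :: "'e set set" where \<B>: "countable \<B>" "\<And>C. C \<in> \<B> \<Longrightarrow> open C"
      "\<And>S. open S \<Longrightarrow> \<exists>U. U \<subseteq> \<B> \<and> S = \<Union>U"
      using univ_second_countable by blast
    have "\<exists>V\<in>\<B>. x \<in> V \<and> V \<subseteq> S" if "open S" "x \<in> S" for S x
      using \<B>(3)[OF that(1)] that(2) by blast
    with \<B>(1,2) show ?thesis
      unfolding second_countable_def open_openin[symmetric] by blast
  qed
qed (simp add: topspace_quotient)

text \<open>Two points lie in one orbit exactly when their displacement is in \<open>L\<close>. As
  \<open>L\<close> is closed and the displacement continuous, a product neighbourhood
  \<open>U \<times> V\<close> of an inequivalent pair avoids this relation, and the open images of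
  \<open>U\<close> and \<open>V\<close> are disjoint.\<close>

lemma Hausdorff_quotient: "Hausdorff_space quotient"
  unfolding Hausdorff_space_def
proof (intro allI impI, elim conjE)
  fix p q assume "p \<in> topspace quotient" "q \<in> topspace quotient" "p \<noteq> q"
  then obtain y z where p: "p = proj y" and q: "q = proj z"
    by (auto simp: topspace_quotient)
  with \<open>p \<noteq> q\<close> have yz: "displacement y z \<notin> L"
    by (simp add: proj_eq_iff)
  have "open ((\<lambda>p. displacement (fst p) (snd p)) -` (- L))"
    using closed_L continuous_displacement by (intro open_vimage) auto
  moreover have "(y, z) \<in> (\<lambda>p. displacement (fst p) (snd p)) -` (- L)" using yz by simp
  ultimately obtain U V where UV: "open U" "open V" "(y, z) \<in> U \<times> V"
    "U \<times> V \<subseteq> (\<lambda>p. displacement (fst p) (snd p)) -` (- L)"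
    by (rule open_prod_elim)
  have "disjnt (proj ` U) (proj ` V)"
    using UV(4) by (fastforce simp: disjnt_iff proj_eq_iff)
  then show "\<exists>U V. openin quotient U \<and> openin quotient V \<and> p \<in> U \<and> q \<in> V \<and> disjnt U V"
    using UV p q openin_proj_image by blast
qed

lemma compact_space_quotient:
  assumes "compact K" "\<And>y. \<exists>n\<in>L. act n y \<in> K"
  shows "compact_space quotient"
proof -
  have "proj ` K = range proj"
    using assms(2) proj_act by (metis (mono_tags, lifting) image_eqI image_subset_iff rangeI subsetI subset_antisym)
  then show ?thesis
    using image_compactin[OF _ continuous_map_proj, of K] assms(1)
    by (simp add: compact_space_def topspace_quotient)
qed

section \<open>Charts as local inverses of the projection\<close>

definition evenly_covering :: "'e set \<Rightarrow> bool" where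
  "evenly_covering U \<longleftrightarrow> open U \<and> inj_on proj U"

text \<open>The displacement vanishes at \<open>(y, y)\<close>, so near this pair it is shorter than
  every nonzero element of \<open>L\<close>. Nearby equivalent points therefore coincide.\<close>

lemma evenly_covering_nbhd: "\<exists>U. evenly_covering U \<and> y \<in> U"
proof -
  obtain e where e: "e > 0" "\<And>n. n \<in> L \<Longrightarrow> norm n < e \<Longrightarrow> n = 0" using L_discrete by blast
  have "open ((\<lambda>p. displacement (fst p) (snd p)) -` ball 0 e)"
    using continuous_displacement by (intro open_vimage) auto
  moreover have "(y, y) \<in> (\<lambda>p. displacement (fst p) (snd p)) -` ball 0 e"
    using e(1) by (simp add: displacement_def)
  ultimately obtain U V where UV: "open U" "open V" "(y, y) \<in> U \<times> V"
    "U \<times> V \<subseteq> (\<lambda>p. displacement (fst p) (snd p)) -` ball 0 e"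
    by (rule open_prod_elim)
  have "inj_on proj (U \<inter> V)"
  proof (rule inj_onI)
    fix a b assume ab: "a \<in> U \<inter> V" "b \<in> U \<inter> V" "proj a = proj b"
    then have "(a, b) \<in> (\<lambda>p. displacement (fst p) (snd p)) -` ball 0 e"
      using UV(4) by blast
    then have "displacement a b = 0"
      using e(2) ab(3) by (simp add: proj_eq_iff)
    then show "a = b" by (metis act_0 act_eq_iff)
  qed
  then show ?thesis using UV by (auto simp: evenly_covering_def)
qed

definition sheet_chart :: "'e set \<Rightarrow> ('e set, 'e) chart" where
  "sheet_chart U = (proj ` U, inv_into U proj)"

definition atlas :: "('e set, 'e) chart set" where
  "atlas = sheet_chart ` Collect evenly_covering"

lemma chart_dom_sheet [simp]: "chart_dom (sheet_chart U) = proj ` U"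
  by (simp add: sheet_chart_def)

lemma sheet_chart_in_atlas [simp]: "evenly_covering U \<Longrightarrow> sheet_chart U \<in> atlas"
  by (simp add: atlas_def)

lemma atlasE:
  assumes "c \<in> atlas"
  obtains U where "evenly_covering U" "c = sheet_chart U"
  using assms by (auto simp: atlas_def)

lemma chart_map_sheet [simp]: "evenly_covering U \<Longrightarrow> y \<in> U \<Longrightarrow> chart_map (sheet_chart U) (proj y) = y"
  by (simp add: sheet_chart_def evenly_covering_def)

lemma chart_img_sheet [simp]: "evenly_covering U \<Longrightarrow> chart_map (sheet_chart U) ` proj ` U = U"
  by (simp add: sheet_chart_def evenly_covering_def inv_into_image_cancel)

lemma proj_chart_map [simp]:
  "c \<in> atlas \<Longrightarrow> p \<in> chart_dom c \<Longrightarrow> proj (chart_map c p) = p"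
  by (elim atlasE) (simp add: sheet_chart_def f_inv_into_f)

lemma open_chart_img: "c \<in> atlas \<Longrightarrow> open (chart_img c)"
  by (elim atlasE) (simp add: evenly_covering_def)

text \<open>This removes charts from coordinate expressions: on its image, every chart has the
  restriction of the one map \<open>proj\<close> as inverse.\<close>

lemma chart_inv_atlas:
  assumes "c \<in> atlas" "y \<in> chart_img c"
  shows "chart_inv c y = proj y" and "proj y \<in> chart_dom c" and "chart_map c (proj y) = y"
proof -
  obtain p where p: "p \<in> chart_dom c" "y = chart_map c p" using assms(2) by auto
  have "chart_inv c y \<in> chart_dom c" "chart_map c (chart_inv c y) = y"
    using inv_into_into[OF assms(2)] f_inv_into_f[OF assms(2)] by auto
  then show "chart_inv c y = proj y" using proj_chart_map[OF assms(1)] by metis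
  show "proj y \<in> chart_dom c" "chart_map c (proj y) = y"
    using p proj_chart_map[OF assms(1)] by auto
qed

text \<open>The two charts lift a point to \<open>y\<close> and to \<open>act n y\<close>. As
  \<open>proj\<close> does not distinguish \<open>x\<close> from \<open>act n x\<close>, the same
  \<open>n\<close> works for all \<open>x\<close> near \<open>y\<close>; on another component of the
  overlap a different element may occur, so the statement is local.\<close>

lemma transition_locally_act:
  assumes "c \<in> atlas" "c' \<in> atlas" "y \<in> chart_map c ` (chart_dom c \<inter> chart_dom c')"
  defines "n \<equiv> displacement y (chart_map c' (proj y))"
  shows "n \<in> L" and "\<exists>W. open W \<and> y \<in> W \<and> (\<forall>x\<in>W. act n x = transition c c' x)"
proof -
  obtain U where U: "evenly_covering U" "c = sheet_chart U" using assms(1) by (rule atlasE)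
  obtain V where V: "evenly_covering V" "c' = sheet_chart V" using assms(2) by (rule atlasE)
  obtain p where p: "p \<in> proj ` U" "p \<in> proj ` V" "y = chart_map c p"
    using assms(3) U V by auto
  then have y: "y \<in> U" "proj y \<in> proj ` V"
    using U proj_chart_map[OF assms(1), of p] by auto
  then obtain z where z: "z \<in> V" "proj y = proj z" by auto
  then have n: "n = displacement y z" using V by (simp add: n_def)
  then show nL: "n \<in> L" using z by (simp flip: proj_eq_iff)
  have "act n y = z" using n by (simp add: act_eq_iff)
  let ?W = "U \<inter> act n -` V"
  have "open ?W"
    using U V continuous_act by (auto simp: evenly_covering_def intro!: open_Int open_vimage)
  moreover have "y \<in> ?W" using y \<open>act n y = z\<close> z by simp
  moreover have "act n x = transition c c' x" if "x \<in> ?W" for x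
  proof -
    have "chart_inv c x = proj x" using that U chart_inv_atlas[OF assms(1)] by simp
    also have "\<dots> = proj (act n x)" using nL by (simp add: proj_act)
    finally show ?thesis using that V by (simp add: transition_def)
  qed
  ultimately show "\<exists>W. open W \<and> y \<in> W \<and> (\<forall>x\<in>W. act n x = transition c c' x)" by blast
qed

lemma has_derivative_act: "(act n has_derivative (\<lambda>w. w - B n w)) (at y)"
  unfolding act_def
  by (auto intro!: derivative_eq_intros bounded_linear_imp_has_derivative[OF B.bounded_linear_right])

lemma smooth_on_act: "smooth_on UNIV (act n)"
proof -
  have "smooth_on UNIV (\<lambda>y. (y + (- B n y)) + n)"
    by (intro smooth_on_add smooth_on_const smooth_on_bounded_linear bounded_linear_ident
        bounded_linear_minus B.bounded_linear_right open_UNIV)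
  then show ?thesis by (simp add: act_def[abs_def] algebra_simps)
qed

text \<open>The local lattice element is the displacement of the two lifts, but its bracket part is
  killed by \<open>B\<close>, so only the difference of the two coordinate values remains in the
  formula.\<close>

lemma frechet_derivative_transition:
  assumes "c \<in> atlas" "c' \<in> atlas" "p \<in> chart_dom c \<inter> chart_dom c'"
  shows "frechet_derivative (transition c c') (at (chart_map c p)) w =
    w - B (chart_map c' p - chart_map c p) w"
proof -
  define y where "y = chart_map c p"
  have y: "y \<in> chart_map c ` (chart_dom c \<inter> chart_dom c')" "proj y = p"
    using assms by (auto simp: y_def)
  obtain W where W: "open W" "y \<in> W"
    "\<And>x. x \<in> W \<Longrightarrow> act (displacement y (chart_map c' (proj y))) x = transition c c' x"
    using transition_locally_act(2)[OF assms(1,2) y(1)] by blast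
  from has_derivative_transform_within_open[OF has_derivative_act W]
  have "(transition c c' has_derivative (\<lambda>w. w - B (displacement y (chart_map c' (proj y))) w)) (at y)" .
  from fun_cong[OF frechet_derivative_at[OF this], of w] show ?thesis
    by (simp add: y(2) displacement_def B_simps flip: y_def)
qed

lemma smooth_manifold_quotient: "smooth_manifold quotient atlas"
  unfolding smooth_manifold_def
proof (intro conjI ballI)
  show "Hausdorff_space quotient" by (rule Hausdorff_quotient)
  show "second_countable quotient" by (rule second_countable_quotient)
  show "(\<Union>c\<in>atlas. chart_dom c) = topspace quotient"
  proof -
    have "proj y \<in> (\<Union>c\<in>atlas. chart_dom c)" for y
      using evenly_covering_nbhd[of y] by (auto simp: atlas_def)
    then show ?thesis by (auto simp: topspace_quotient atlas_def)
  qed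
next
  fix c assume "c \<in> atlas"
  then obtain U where U: "evenly_covering U" "c = sheet_chart U" by (rule atlasE)
  have oU: "open U" and inj: "inj_on proj U" using U(1) by (auto simp: evenly_covering_def)
  have dom: "openin quotient (chart_dom c)" using U openin_proj_image[OF oU] by simp
  have "homeomorphic_map (top_of_set U) (subtopology quotient (proj ` U)) proj"
  proof (rule bijective_open_imp_homeomorphic_map)
    show "continuous_map (top_of_set U) (subtopology quotient (proj ` U)) proj"
      using continuous_map_from_subtopology[OF continuous_map_proj]
      by (auto simp: continuous_map_in_subtopology)
    show "open_map (top_of_set U) (subtopology quotient (proj ` U)) proj"
      unfolding open_map_def
    proof (intro allI impI)
      fix T assume "openin (top_of_set U) T"
      then have "open T" "T \<subseteq> U" using oU openin_open_eq by auto
      then show "openin (subtopology quotient (proj ` U)) (proj ` T)"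
        using openin_proj_image[of T] by (auto simp: openin_subtopology)
    qed
    show "proj ` topspace (top_of_set U) = topspace (subtopology quotient (proj ` U))"
      by (auto simp: topspace_quotient)
  qed (use inj in simp)
  then obtain g where g: "homeomorphic_maps (top_of_set U) (subtopology quotient (proj ` U)) proj g"
    by (auto simp: homeomorphic_map_maps)
  \<comment> \<open>The inverse \<open>g\<close> obtained above is only known abstractly;
    injectivity of \<open>proj\<close> on \<open>U\<close> identifies it with the coordinate
    map.\<close>
  have "homeomorphic_map (subtopology quotient (proj ` U)) (top_of_set U) (inv_into U proj)"
  proof (rule homeomorphic_map_eq)
    show "homeomorphic_map (subtopology quotient (proj ` U)) (top_of_set U) g"
      using g by (simp add: homeomorphic_maps_map)
    show "g p = inv_into U proj p" if "p \<in> topspace (subtopology quotient (proj ` U))" for p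
      using that g inj by (auto simp: homeomorphic_maps_def)
  qed
  then show "is_chart quotient c"
    using dom oU U inj by (simp add: is_chart_def sheet_chart_def inv_into_image_cancel)
next
  fix c c' assume c: "c \<in> atlas" "c' \<in> atlas"
  show "smooth_on (chart_map c ` (chart_dom c \<inter> chart_dom c')) (transition c c')"
  proof (rule smooth_on_local)
    fix y assume "y \<in> chart_map c ` (chart_dom c \<inter> chart_dom c')"
    from transition_locally_act(2)[OF c this]
    obtain n W where "open W" "y \<in> W" "\<And>x. x \<in> W \<Longrightarrow> act n x = transition c c' x" by blast
    then show "\<exists>T. open T \<and> y \<in> T \<and> smooth_on T (transition c c')"
      using smooth_on_cong[of W "act n"] smooth_on_subset[OF smooth_on_act] by blast
  qed
qed

subsection \<open>Vector fields on the quotient\<close>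

lemma frechet_derivative_near_chart:
  fixes f :: "'e \<Rightarrow> 'b::real_normed_vector"
  assumes "c \<in> atlas" "x \<in> chart_img c" "\<And>z. z \<in> chart_img c \<Longrightarrow> f z = g z" "f differentiable (at x)"
  shows "frechet_derivative g (at x) = frechet_derivative f (at x)"
  using frechet_derivative_transform_within_open[OF assms(4) open_chart_img[OF assms(1)] assms(2,3)]
  by simp

text \<open>
  The tangent vector at \<open>proj y\<close> that is represented by the vector \<open>w\<close> at the point \<open>y\<close> of the
  universal covering.
\<close>

definition tvec_at :: "'e \<Rightarrow> 'e \<Rightarrow> ('e set, 'e) tvec" where
  "tvec_at y w = (\<lambda>c. if c \<in> atlas \<and> proj y \<in> chart_dom c
     then w - B (chart_map c (proj y) - y) w else 0)"

lemma tvec_at_chart: "c \<in> atlas \<Longrightarrow> y \<in> chart_img c \<Longrightarrow> tvec_at y w c = w"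
  using chart_inv_atlas[of c y] by (simp add: tvec_at_def B.zero_left)

lemma chart_around: "\<exists>c\<in>atlas. y \<in> chart_img c"
  using evenly_covering_nbhd[of y] by (force simp: atlas_def)

lemma tvec_at_eq_iff: "tvec_at y w = tvec_at y w' \<longleftrightarrow> w = w'"
  using chart_around[of y] tvec_at_chart by metis

lemma tvec_at_0: "tvec_at y 0 = 0"
  by (auto simp: tvec_at_def B_simps fun_eq_iff)

lemma tvec_at_act:
  assumes "n \<in> L"
  shows "tvec_at (act n y) (w - B n w) = tvec_at y w"
  unfolding tvec_at_def proj_act[OF assms] by (auto simp: act_def B_simps fun_eq_iff)

lemma tvec_at_in_tangent_space: "tvec_at y w \<in> tangent_space atlas (proj y)"
  by (auto simp: tangent_space_def frechet_derivative_transition tvec_at_def B_simps)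

text \<open>Some chart image contains \<open>y\<close> itself; the component of a tangent vector in
  that chart is its representative at \<open>y\<close> and determines all other components through
  the transitions.\<close>

lemma tangent_space_proj: "tangent_space atlas (proj y) = range (tvec_at y)"
proof (intro subset_antisym subsetI)
  fix v assume v: "v \<in> tangent_space atlas (proj y)"
  obtain c where c: "c \<in> atlas" "y \<in> chart_img c" using chart_around by blast
  have "v c' = v c - B (chart_map c' (proj y) - y) (v c)"
    if "c' \<in> atlas" "proj y \<in> chart_dom c'" for c'
  proof -
    have "proj y \<in> chart_dom c \<inter> chart_dom c'" "chart_map c (proj y) = y"
      using that chart_inv_atlas[OF c] by simp_all
    moreover have "v c' = frechet_derivative (transition c c') (at (chart_map c (proj y))) (v c)"
      using v c(1) that(1) calculation(1) unfolding tangent_space_def by blast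
    ultimately show ?thesis
      using frechet_derivative_transition[OF c(1) that(1), of "proj y" "v c"] by simp
  qed
  moreover have "v c' = 0" if "\<not> (c' \<in> atlas \<and> proj y \<in> chart_dom c')" for c'
    using v that unfolding tangent_space_def by blast
  ultimately have "v = tvec_at y (v c)"
    unfolding tvec_at_def by (intro ext) presburger
  then show "v \<in> range (tvec_at y)" by (rule range_eqI)
qed (auto simp: tvec_at_in_tangent_space)

lemma chart_dom_subset: "c \<in> atlas \<Longrightarrow> chart_dom c \<subseteq> range proj"
  by (elim atlasE) auto

text \<open>Sets that are not orbits also belong to the carrier type, and the definitions quantify
  over them too; there the tangent space is trivial.\<close>

lemma tangent_space_cases [consumes 1, case_names inside outside]:
  assumes "v \<in> tangent_space atlas p"
  obtains y w where "p = proj y" "v = tvec_at y w" | "p \<notin> range proj" "v = 0"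
proof (cases "p \<in> range proj")
  case True
  then show ?thesis using assms that(1) tangent_space_proj by auto
next
  case False
  then have "c \<notin> atlas \<or> p \<notin> chart_dom c" for c
    using chart_dom_subset by blast
  then have "v c = 0" for c
    using assms unfolding tangent_space_def by blast
  then have "v = 0" by (simp add: fun_eq_iff)
  then show ?thesis using False that(2) by blast
qed

lemma coord_vec_atlas:
  assumes "c \<in> atlas" "y \<in> chart_img c"
  shows "coord_vec atlas c e (proj y) = tvec_at y e"
proof
  fix c'
  show "coord_vec atlas c e (proj y) c' = tvec_at y e c'"
    using chart_inv_atlas[OF assms] frechet_derivative_transition[OF assms(1), of c' "proj y" e]
    by (simp add: coord_vec_def tvec_at_def)
qed

text \<open>Invariance of \<open>W\<close>, read as a vector field on the covering, under the
  lattice: \<open>1 - B n\<close> is the differential of \<open>act n\<close> at every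
  point.\<close>

definition equivariant :: "('e \<Rightarrow> 'e) \<Rightarrow> bool" where
  "equivariant W \<longleftrightarrow> (\<forall>n\<in>L. \<forall>y. W (act n y) = W y - B n (W y))"

definition field :: "('e \<Rightarrow> 'e) \<Rightarrow> ('e set, 'e) vfield" where
  "field W p c = (if c \<in> atlas \<and> p \<in> chart_dom c then W (chart_map c p) else 0)"

lemma equivariantD:
  assumes "equivariant W" "proj z = proj y"
  shows "W z = W y - B (z - y) (W y)"
proof -
  have "displacement y z \<in> L" using assms(2) by (metis proj_eq_iff)
  then have "W (act (displacement y z) y) = W y - B (displacement y z) (W y)"
    using assms(1) by (simp add: equivariant_def)
  moreover have "act (displacement y z) y = z" by (simp add: act_eq_iff)
  ultimately show ?thesis by (simp add: displacement_def B_simps)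
qed

lemma field_proj: "equivariant W \<Longrightarrow> field W (proj y) = tvec_at y (W y)"
proof
  fix c assume "equivariant W"
  then show "field W (proj y) c = tvec_at y (W y) c"
    using equivariantD[of W "chart_map c (proj y)" y] by (simp add: field_def tvec_at_def)
qed

lemma field_outside: "p \<notin> range proj \<Longrightarrow> field W p = 0"
  using chart_dom_subset by (fastforce simp: field_def fun_eq_iff)

lemma field_chart_inv: "c \<in> atlas \<Longrightarrow> x \<in> chart_img c \<Longrightarrow> field W (chart_inv c x) c = W x"
  by (simp add: chart_inv_atlas field_def)

lemma field_add: "field V + field W = field (\<lambda>y. V y + W y)"
  by (auto simp: field_def fun_eq_iff)

lemma field_diff: "field V - field W = field (\<lambda>y. V y - W y)"
  by (auto simp: field_def fun_eq_iff)

lemma field_0: "field (\<lambda>y. 0) = 0"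
  by (auto simp: field_def fun_eq_iff)

lemma fscale_field: "fscale f (field W) = field (\<lambda>y. f (proj y) *\<^sub>R W y)"
  by (intro ext) (simp add: field_def fscale_def tscale_def)

lemma equivariant_add: "equivariant V \<Longrightarrow> equivariant W \<Longrightarrow> equivariant (\<lambda>y. V y + W y)"
  by (auto simp: equivariant_def B_simps)

lemma equivariant_scale: "equivariant W \<Longrightarrow> equivariant (\<lambda>y. f (proj y) *\<^sub>R W y)"
  by (simp add: equivariant_def proj_act B.scaleR_right scaleR_diff_right)

lemma field_in_vector_fields:
  assumes "equivariant W" "smooth_on UNIV W"
  shows "field W \<in> vector_fields atlas"
  unfolding vector_fields_def
proof (intro CollectI conjI allI ballI)
  fix p
  show "field W p \<in> tangent_space atlas p"
  proof (cases "p \<in> range proj")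
    case True
    then show ?thesis using field_proj[OF assms(1)] tvec_at_in_tangent_space by auto
  next
    case False
    then have "p \<notin> chart_dom c" if "c \<in> atlas" for c
      using chart_dom_subset that by blast
    then show ?thesis
      by (simp add: tangent_space_def field_outside[OF False])
  qed
next
  fix c assume c: "c \<in> atlas"
  show "smooth_on (chart_img c) (\<lambda>x. field W (chart_inv c x) c)"
    by (rule smooth_on_cong[OF open_chart_img[OF c] _ smooth_on_subset[OF assms(2) subset_UNIV]])
      (simp add: field_chart_inv c)
qed

text \<open>Together with \<open>field_in_vector_fields\<close> this identifies smooth vector fields
  with smooth equivariant maps. Equivariance of the lift holds because \<open>y\<close> and
  \<open>act n y\<close> give two representatives of one tangent vector; smoothness is local, and
  near \<open>y\<close> the lift is the coordinate expression in a chart through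
  \<open>y\<close>.\<close>

lemma vector_fieldsE:
  assumes "X \<in> vector_fields atlas"
  obtains W where "equivariant W" "smooth_on UNIV W" "X = field W"
proof -
  have "\<forall>y. \<exists>w. X (proj y) = tvec_at y w"
    using assms tangent_space_proj by (force simp: vector_fields_def)
  then obtain W where W: "\<And>y. X (proj y) = tvec_at y (W y)" by metis
  have eqv: "equivariant W"
    unfolding equivariant_def
  proof (intro ballI allI)
    fix n y assume "n \<in> L"
    then have "tvec_at (act n y) (W (act n y)) = tvec_at (act n y) (W y - B n (W y))"
      using W by (metis proj_act tvec_at_act)
    then show "W (act n y) = W y - B n (W y)" by (simp add: tvec_at_eq_iff)
  qed
  have "smooth_on UNIV W"
  proof (rule smooth_on_local)
    fix y
    obtain c where c: "c \<in> atlas" "y \<in> chart_img c" using chart_around by blast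
    have "smooth_on (chart_img c) (\<lambda>x. X (chart_inv c x) c)"
      using assms c by (simp add: vector_fields_def)
    then have "smooth_on (chart_img c) W"
      by (rule smooth_on_cong[OF open_chart_img[OF c(1)], rotated])
        (simp add: chart_inv_atlas c W tvec_at_chart)
    then show "\<exists>T. open T \<and> y \<in> T \<and> smooth_on T W"
      using c open_chart_img by blast
  qed
  moreover have "X = field W"
  proof
    fix p
    have "X p \<in> tangent_space atlas p" using assms by (simp add: vector_fields_def)
    then show "X p = field W p"
      by (cases rule: tangent_space_cases) (auto simp: W field_proj[OF eqv] field_outside)
  qed
  ultimately show ?thesis using eqv that by blast
qed

section \<open>The flat connection on the quotient\<close>

definition lift :: "('e set, 'e) vfield \<Rightarrow> 'e \<Rightarrow> 'e" where
  "lift X y = (THE w. X (proj y) = tvec_at y w)"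

lemma lift_field: "equivariant W \<Longrightarrow> lift (field W) = W"
  by (rule ext) (auto simp: lift_def field_proj tvec_at_eq_iff)

text \<open>
  The action is by affine maps, so the flat connection of the universal covering descends.
\<close>

definition conn :: "('e set, 'e) connection" where
  "conn X Y = field (\<lambda>y. frechet_derivative (lift Y) (at y) (lift X y))"

lemma conn_field:
  "equivariant V \<Longrightarrow> equivariant W \<Longrightarrow>
    conn (field V) (field W) = field (\<lambda>y. frechet_derivative W (at y) (V y))"
  by (simp add: conn_def lift_field)

lemma frechet_derivative_act:
  assumes "\<And>y. f (act n y) = g y" "f differentiable (at (act n y))"
  shows "frechet_derivative f (at (act n y)) (v - B n v) = frechet_derivative g (at y) v"
proof -
  have "(f has_derivative frechet_derivative f (at (act n y))) (at (act n y))"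
    using assms(2) by (rule iffD1[OF frechet_derivative_works])
  from has_derivative_compose[OF has_derivative_act this]
  have "(g has_derivative (\<lambda>v. frechet_derivative f (at (act n y)) (v - B n v))) (at y)"
    by (simp only: assms(1))
  from fun_cong[OF frechet_derivative_at[OF this], of v] show ?thesis .
qed

text \<open>Differentiate \<open>W (act n y) = W y - B n (W y)\<close> along \<open>V\<close>. Since
  \<open>act n\<close> is affine, no derivative of its differential appears.\<close>

lemma equivariant_frechet_derivative:
  assumes V: "equivariant V" and W: "equivariant W" "smooth_on UNIV W"
  shows "equivariant (\<lambda>y. frechet_derivative W (at y) (V y))"
  unfolding equivariant_def
proof (intro ballI allI)
  fix n y assume n: "n \<in> L"
  have d: "W differentiable (at z)" for z
    using W(2) by (rule smooth_on_imp_differentiable) simp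
  have "frechet_derivative W (at (act n y)) (V (act n y)) =
      frechet_derivative W (at (act n y)) (V y - B n (V y))"
    using V n by (simp add: equivariant_def)
  also have "\<dots> = frechet_derivative (\<lambda>y. W y - B n (W y)) (at y) (V y)"
    using W(1) n by (intro frechet_derivative_act d) (simp add: equivariant_def)
  also have "\<dots> = frechet_derivative W (at y) (V y) - B n (frechet_derivative W (at y) (V y))"
    by (rule frechet_derivative_bounded_linear_comp[OF _ d])
      (intro bounded_linear_sub bounded_linear_ident B.bounded_linear_right)
  finally show "frechet_derivative W (at (act n y)) (V (act n y)) =
    frechet_derivative W (at y) (V y) - B n (frechet_derivative W (at y) (V y))" .
qed

lemma smooth_function_proj:
  assumes "smooth_function atlas f"
  shows "smooth_on UNIV (\<lambda>y. f (proj y))"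
proof (rule smooth_on_local)
  fix y
  obtain c where c: "c \<in> atlas" "y \<in> chart_img c" using chart_around by blast
  have "smooth_on (chart_img c) (f \<circ> chart_inv c)"
    using assms c by (simp add: smooth_function_def)
  then have "smooth_on (chart_img c) (\<lambda>y. f (proj y))"
    by (rule smooth_on_cong[OF open_chart_img[OF c(1)], rotated]) (simp add: chart_inv_atlas c)
  then show "\<exists>T. open T \<and> y \<in> T \<and> smooth_on T (\<lambda>y. f (proj y))"
    using c open_chart_img by blast
qed

lemma vf_deriv_field:
  assumes V: "equivariant V" and f: "smooth_on UNIV (\<lambda>y. f (proj y))"
  shows "vf_deriv atlas (field V) f (proj y) = frechet_derivative (\<lambda>y. f (proj y)) (at y) (V y)"
proof -
  define c where "c = (SOME c. c \<in> atlas \<and> proj y \<in> chart_dom c)"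
  have "\<exists>c. c \<in> atlas \<and> proj y \<in> chart_dom c"
    using chart_around chart_inv_atlas(2) by blast
  then have c: "c \<in> atlas" "proj y \<in> chart_dom c"
    unfolding c_def by (metis (mono_tags, lifting) someI_ex)+
  \<comment> \<open>The chart chosen by \<open>SOME\<close> may pass through a point
    \<open>z\<close> of the orbit other than \<open>y\<close>; the lattice element \<open>n\<close>
    carries the computation back to \<open>y\<close>.\<close>
  define z where "z = chart_map c (proj y)"
  have z: "z \<in> chart_img c" "proj z = proj y" using c by (simp_all add: z_def)
  define n where "n = displacement y z"
  have n: "n \<in> L" "act n y = z" using z(2) by (auto simp: n_def act_eq_iff simp flip: proj_eq_iff)
  have d: "(\<lambda>y. f (proj y)) differentiable (at x)" for x
    using f by (rule smooth_on_imp_differentiable) simp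
  have "vf_deriv atlas (field V) f (proj y) = frechet_derivative (f \<circ> chart_inv c) (at z) (V z)"
    unfolding vf_deriv_def c_def[symmetric] Let_def using c by (simp add: field_def z_def)
  also have "\<dots> = frechet_derivative (\<lambda>y. f (proj y)) (at z) (V z)"
    using frechet_derivative_near_chart[OF c(1) z(1) _ d, of "f \<circ> chart_inv c"]
    by (simp add: chart_inv_atlas c)
  also have "\<dots> = frechet_derivative (\<lambda>y. f (proj y)) (at (act n y)) (V y - B n (V y))"
    using V n by (auto simp: equivariant_def)
  also have "\<dots> = frechet_derivative (\<lambda>y. f (proj y)) (at y) (V y)"
    using n by (intro frechet_derivative_act d) (simp add: proj_act)
  finally show ?thesis .
qed

lemma lie_bracket_field:
  assumes "smooth_on UNIV V" "smooth_on UNIV W"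
  shows "lie_bracket atlas (field V) (field W) =
    field (\<lambda>y. frechet_derivative W (at y) (V y) - frechet_derivative V (at y) (W y))"
proof (intro ext)
  fix p c
  show "lie_bracket atlas (field V) (field W) p c =
    field (\<lambda>y. frechet_derivative W (at y) (V y) - frechet_derivative V (at y) (W y)) p c"
  proof (cases "c \<in> atlas \<and> p \<in> chart_dom c")
    case True
    then have d: "frechet_derivative (\<lambda>x. field U (chart_inv c x) c) (at (chart_map c p)) =
        frechet_derivative U (at (chart_map c p))" if "smooth_on UNIV U" for U
      using that
      by (intro frechet_derivative_near_chart)
        (auto simp: field_chart_inv intro: smooth_on_imp_differentiable)
    have "field U p c = U (chart_map c p)" for U
      using True by (simp add: field_def)
    then show ?thesis using True by (simp add: lie_bracket_def d[OF assms(1)] d[OF assms(2)])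
  next
    case False
    then show ?thesis by (simp only: lie_bracket_def field_def if_not_P[OF False] if_False)
  qed
qed

lemma affine_connection_conn: "affine_connection atlas conn"
  unfolding affine_connection_def
proof (intro ballI conjI allI impI)
  fix X Y assume "X \<in> vector_fields atlas" "Y \<in> vector_fields atlas"
  then obtain V W where V: "equivariant V" "smooth_on UNIV V" "X = field V"
    and W: "equivariant W" "smooth_on UNIV W" "Y = field W"
    by (metis vector_fieldsE)
  show "conn X Y \<in> vector_fields atlas"
    using V W
    by (simp add: conn_field field_in_vector_fields equivariant_frechet_derivative
        smooth_on_frechet_derivative)
  {
    fix Z assume "Z \<in> vector_fields atlas"
    then obtain U where U: "equivariant U" "smooth_on UNIV U" "Z = field U"
      by (metis vector_fieldsE)
    show "conn (X + Y) Z = conn X Z + conn Y Z"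
      using U V W by (simp add: field_add conn_field equivariant_add linear_add[OF linear_frechet_smooth])
    show "conn X (Y + Z) = conn X Y + conn X Z"
      using U V W by (simp add: field_add conn_field equivariant_add frechet_derivative_add)
  }
  fix f assume "smooth_function atlas f"
  then have f: "smooth_on UNIV (\<lambda>y. f (proj y))" by (rule smooth_function_proj)
  show "conn (fscale f X) Y = fscale f (conn X Y)"
    using V W
    by (simp add: fscale_field conn_field equivariant_scale linear_cmul[OF linear_frechet_smooth])
  show "conn X (fscale f Y) = fscale (vf_deriv atlas X f) Y + fscale f (conn X Y)"
    using V W f
    by (simp add: vf_deriv_field fscale_field conn_field equivariant_scale field_add
        frechet_derivative_bilinear[OF bounded_bilinear_scaleR] add.commute)
qed

lemma torsion_free_conn:
  assumes "X \<in> vector_fields atlas" "Y \<in> vector_fields atlas"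
  shows "conn X Y - conn Y X = lie_bracket atlas X Y"
proof -
  obtain V W where V: "equivariant V" "smooth_on UNIV V" "X = field V"
    and W: "equivariant W" "smooth_on UNIV W" "Y = field W"
    using assms by (metis vector_fieldsE)
  then show ?thesis by (simp add: conn_field field_diff lie_bracket_field)
qed

text \<open>Expanding the iterated derivatives of \<open>W\<close> leaves second derivatives along
  \<open>U\<close> and \<open>V\<close>, which cancel by symmetry, and first derivatives of
  \<open>W\<close> along the bracket, which the last curvature term removes.\<close>

lemma flat_conn: "flat atlas conn"
  unfolding flat_def curvature_def
proof (intro ballI)
  fix X Y Z assume "X \<in> vector_fields atlas" "Y \<in> vector_fields atlas" "Z \<in> vector_fields atlas"
  then obtain U V W where U: "equivariant U" "smooth_on UNIV U" "X = field U"
    and V: "equivariant V" "smooth_on UNIV V" "Y = field V"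
    and W: "equivariant W" "smooth_on UNIV W" "Z = field W"
    by (metis vector_fieldsE)
  let ?d = "\<lambda>V W y. frechet_derivative W (at y) (V y)"
  have bracket: "lie_bracket atlas X Y = field (\<lambda>y. ?d U V y - ?d V U y)"
    using U V by (simp add: lie_bracket_field)
  have eqv: "equivariant (?d U W)" "equivariant (?d V W)" "equivariant (?d U V)" "equivariant (?d V U)"
    using U V W by (simp_all add: equivariant_frechet_derivative)
  have "equivariant (\<lambda>y. ?d U V y - ?d V U y)"
    using eqv(3,4) by (auto simp: equivariant_def B_simps)
  then have "conn X (conn Y Z) - conn Y (conn X Z) - conn (lie_bracket atlas X Y) Z =
      field (\<lambda>y. ?d U (?d V W) y - ?d V (?d U W) y - frechet_derivative W (at y) (?d U V y - ?d V U y))"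
    unfolding bracket using U V W eqv by (simp add: conn_field field_diff)
  also have "\<dots> = field (\<lambda>y. 0)"
  proof -
    have "?d U (?d V W) y - ?d V (?d U W) y - frechet_derivative W (at y) (?d U V y - ?d V U y) = 0" for y
      using second_derivative_symmetric[OF W(2), of "V y" y "U y"]
      by (simp add: frechet_derivative_along_field[OF W(2) U(2)]
          frechet_derivative_along_field[OF W(2) V(2)] linear_diff[OF linear_frechet_smooth[OF W(2)]])
    then show ?thesis by simp
  qed
  finally show "conn X (conn Y Z) - conn Y (conn X Z) - conn (lie_bracket atlas X Y) Z = 0"
    by (simp add: field_0)
qed

end

subsection \<open>The nearly para-Kaehler structure\<close>

text \<open>\<open>S_B\<close> puts the values of \<open>B\<close> into the eigenspace
  \<open>S = 1\<close>, and \<open>B_S_left\<close> makes \<open>B\<close> vanish there.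
  \<open>G_B_skew\<close> and the alternation of \<open>B\<close> make \<open>G (B x y) z\<close> an
  alternating three-form; \<open>G_S_skew\<close> makes both eigenspaces of \<open>S\<close>
  null.\<close>

locale nil_lattice_para_complex = nil_lattice B L
  for B :: "'e::euclidean_space \<Rightarrow> 'e \<Rightarrow> 'e" and L +
  fixes S :: "'e \<Rightarrow> 'e" and G :: "'e \<Rightarrow> 'e \<Rightarrow> real"
  assumes bounded_linear_S: "bounded_linear S"
    and S_S [simp]: "S (S x) = x"
    and S_B [simp]: "S (B x y) = B x y"
    and B_S_left [simp]: "B (S x) y = - B x y"
    and bilinear_G: "bounded_bilinear G"
    and G_commute: "G x y = G y x"
    and G_nondegenerate: "(\<And>y. G x y = 0) \<Longrightarrow> x = 0"
    and G_B_skew: "G (B x y) z = - G y (B x z)"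
    and G_S_skew: "G (S x) y = - G x (S y)"
begin

lemmas S_linear =
  bounded_linear.linear[OF bounded_linear_S, THEN linear_add]
  bounded_linear.linear[OF bounded_linear_S, THEN linear_diff]
  bounded_linear.linear[OF bounded_linear_S, THEN linear_cmul]
  bounded_linear.linear[OF bounded_linear_S, THEN linear_0]

sublocale G: bounded_bilinear G
  by (rule bilinear_G)

lemma B_S_right [simp]: "B y (S x) = - B y x"
  using B_S_left[of x y] B_antisym[of y "S x"] B_antisym[of y x] by simp

lemma G_B_B: "G (B x y) (B u v) = 0"
  by (simp add: G_B_skew G.zero_right)

text \<open>The linear parts of the action are isometries: the terms of first order in
  \<open>x\<close> cancel by skewness, and the second order term vanishes because the image of
  \<open>B\<close> is isotropic.\<close>

lemma G_shear: "G (w - B x w) (w' - B x w') = G w w'"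
  using G_B_skew[of x w w'] by (simp add: G.diff_left G.diff_right G_B_B)

text \<open>Any chart around \<open>p\<close> may be chosen, because the differentials of the
  transitions preserve \<open>G\<close> by \<open>G_shear\<close>.\<close>

definition metric :: "('e set, 'e) metric_field" where
  "metric p u v = (let c = SOME c. c \<in> atlas \<and> p \<in> chart_dom c in G (u c) (v c))"

definition J_flat :: "'e \<Rightarrow> 'e \<Rightarrow> 'e" where
  "J_flat y w = S w + 2 *\<^sub>R B y w"

text \<open>All components are transformed at once. At an index that is not a chart around
  \<open>p\<close>, the base point is meaningless, but \<open>u c = 0\<close> for tangent vectors
  and \<open>J_flat\<close> fixes 0, so the padding survives.\<close>

definition J :: "('e set, 'e) endo_field" where
  "J p u = (\<lambda>c. J_flat (chart_map c p) (u c))"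

lemma metric_tvec_at: "metric (proj y) (tvec_at y w) (tvec_at y w') = G w w'"
proof -
  define c where "c = (SOME c. c \<in> atlas \<and> proj y \<in> chart_dom c)"
  have "\<exists>c. c \<in> atlas \<and> proj y \<in> chart_dom c"
    using chart_around chart_inv_atlas(2) by blast
  then have "c \<in> atlas \<and> proj y \<in> chart_dom c"
    unfolding c_def by (rule someI_ex)
  then show ?thesis
    unfolding metric_def c_def[symmetric] Let_def by (simp add: tvec_at_def G_shear)
qed

lemma metric_0_0: "metric p 0 0 = 0"
  by (simp add: metric_def Let_def G.zero_left)

lemma J_flat_0 [simp]: "J_flat y 0 = 0"
  by (simp add: J_flat_def S_linear B.zero_right)

lemma J_0: "J p 0 = 0"
  by (simp add: J_def fun_eq_iff)

text \<open>Changing the lift from \<open>y\<close> to \<open>z\<close> changes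
  \<open>J_flat\<close> by \<open>2 B (z - y)\<close>, which is exactly the commutator of
  \<open>S\<close> with \<open>B (z - y)\<close> coming from the transition.\<close>

lemma J_tvec_at: "J (proj y) (tvec_at y w) = tvec_at y (J_flat y w)"
proof
  fix c
  show "J (proj y) (tvec_at y w) c = tvec_at y (J_flat y w) c"
    by (simp add: J_def tvec_at_def)
      (simp add: J_flat_def B_simps S_linear scaleR_2 algebra_simps)
qed

lemma J_flat_add: "J_flat y (u + v) = J_flat y u + J_flat y v"
  by (simp add: J_flat_def S_linear B.add_right scaleR_add_right)

lemma J_flat_scale: "J_flat y (a *\<^sub>R u) = a *\<^sub>R J_flat y u"
  by (simp add: J_flat_def S_linear B.scaleR_right scaleR_add_right)

lemma J_flat_J_flat: "J_flat y (J_flat y u) = u"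
  by (simp add: J_flat_def S_linear B_simps B.scaleR_right)

lemma G_J_flat: "G (J_flat y u) v = - G u (J_flat y v)"
  by (simp add: J_flat_def G.add_left G.add_right G.scaleR_left G.scaleR_right G_S_skew G_B_skew)

lemma pseudo_riemannian_metric_metric: "pseudo_riemannian_metric atlas metric"
  unfolding pseudo_riemannian_metric_def
proof (intro conjI allI ballI impI)
  fix p u v w a
  assume u: "u \<in> tangent_space atlas p" and v: "v \<in> tangent_space atlas p"
  show "metric p u v = metric p v u"
    unfolding metric_def by (simp add: G_commute)
  show "metric p (tscale a u) v = a * metric p u v"
    by (simp add: metric_def Let_def tscale_def G.scaleR_left)
  show "metric p (u + v) w = metric p u w + metric p v w"
    by (simp add: metric_def Let_def G.add_left)
next
  fix p u assume u: "u \<in> tangent_space atlas p" and *: "\<forall>v\<in>tangent_space atlas p. metric p u v = 0"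
  from u show "u = 0"
  proof (cases rule: tangent_space_cases)
    case (inside y w)
    have "G w w' = 0" for w'
      using * inside tvec_at_in_tangent_space[of y w'] metric_tvec_at[of y w w'] by auto
    then show ?thesis using G_nondegenerate[of w] inside by (simp add: tvec_at_0)
  qed
next
  fix c e e' assume c: "c \<in> atlas"
  show "smooth_on (chart_img c)
      (\<lambda>x. let p = chart_inv c x in metric p (coord_vec atlas c e p) (coord_vec atlas c e' p))"
    by (rule smooth_on_cong[OF open_chart_img[OF c] _ smooth_on_const[of _ "G e e'"]])
      (simp add: chart_inv_atlas(1) c coord_vec_atlas metric_tvec_at)
qed

lemma smooth_on_J_flat:
  assumes "smooth_on UNIV W"
  shows "smooth_on UNIV (\<lambda>y. S (W y))" "smooth_on UNIV (\<lambda>y. B y (W y))"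
    "smooth_on UNIV (\<lambda>y. 2 *\<^sub>R B y (W y))" "smooth_on UNIV (\<lambda>y. J_flat y (W y))"
proof -
  \<comment> \<open>Fixing \<open>r = 1\<close> makes composition with the linear map
    \<open>S\<close> an instance of \<open>smooth_on_bilinear\<close>.\<close>
  have "bounded_bilinear (\<lambda>(r::real) x. r *\<^sub>R S x)"
    by (rule bounded_bilinear.comp[OF bounded_bilinear_scaleR bounded_linear_ident bounded_linear_S])
  from smooth_on_bilinear[OF this open_UNIV smooth_on_const[of _ 1] assms]
  show 1: "smooth_on UNIV (\<lambda>y. S (W y))" by simp
  show 2: "smooth_on UNIV (\<lambda>y. B y (W y))"
    by (intro smooth_on_bilinear[OF bilinear] smooth_on_bounded_linear bounded_linear_ident assms open_UNIV)
  show 3: "smooth_on UNIV (\<lambda>y. 2 *\<^sub>R B y (W y))"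
    by (intro smooth_on_bilinear[OF bounded_bilinear_scaleR] smooth_on_const 2 open_UNIV)
  show "smooth_on UNIV (\<lambda>y. J_flat y (W y))"
    unfolding J_flat_def by (intro smooth_on_add 1 3 open_UNIV)
qed

lemma endomorphism_field_J: "endomorphism_field atlas J"
  unfolding endomorphism_field_def
proof (intro conjI allI ballI)
  fix p u a assume u: "u \<in> tangent_space atlas p"
  then show "J p u \<in> tangent_space atlas p"
  proof (cases rule: tangent_space_cases)
    case (inside y w)
    then show ?thesis by (simp add: J_tvec_at tvec_at_in_tangent_space)
  next
    case outside
    then show ?thesis using u by (simp add: J_0)
  qed
  show "J p (tscale a u) = tscale a (J p u)"
    by (simp add: J_def tscale_def J_flat_scale)
  fix v
  show "J p (u + v) = J p u + J p v"
    by (simp add: J_def J_flat_add fun_eq_iff)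
next
  fix c e assume c: "c \<in> atlas"
  show "smooth_on (chart_img c) (\<lambda>x. let p = chart_inv c x in J p (coord_vec atlas c e p) c)"
    by (rule smooth_on_cong[OF open_chart_img[OF c] _
          smooth_on_subset[OF smooth_on_J_flat(4)[OF smooth_on_const[of _ e]] subset_UNIV]])
      (simp add: chart_inv_atlas(1) c coord_vec_atlas J_tvec_at tvec_at_chart)
qed

text \<open>On the covering the metric is the constant form \<open>G\<close>, so compatibility is
  the product rule for \<open>G (V y) (W y)\<close>.\<close>

lemma levi_civita_connection_conn: "levi_civita_connection quotient atlas metric conn"
  unfolding levi_civita_connection_def
proof (intro conjI ballI affine_connection_conn torsion_free_conn)
  fix X Y Z p
  assume "X \<in> vector_fields atlas" "Y \<in> vector_fields atlas" "Z \<in> vector_fields atlas"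
    and "p \<in> topspace quotient"
  then obtain U V W y where U: "equivariant U" "smooth_on UNIV U" "X = field U"
    and V: "equivariant V" "smooth_on UNIV V" "Y = field V"
    and W: "equivariant W" "smooth_on UNIV W" "Z = field W" and p: "p = proj y"
    unfolding topspace_quotient by (metis vector_fieldsE imageE)
  let ?f = "\<lambda>q. metric q (Y q) (Z q)"
  have f: "(\<lambda>y. ?f (proj y)) = (\<lambda>y. G (V y) (W y))"
    using V W by (simp add: field_proj metric_tvec_at)
  moreover have "smooth_on UNIV (\<lambda>y. G (V y) (W y))"
    by (intro smooth_on_bilinear[OF bilinear_G] V W open_UNIV)
  ultimately have "vf_deriv atlas X ?f p = frechet_derivative (\<lambda>y. G (V y) (W y)) (at y) (U y)"
    using vf_deriv_field[OF U(1), of ?f y] U(3) p by simp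
  also have "\<dots> = G (frechet_derivative V (at y) (U y)) (W y) + G (V y) (frechet_derivative W (at y) (U y))"
    by (simp add: frechet_derivative_bilinear[OF bilinear_G V(2) W(2)])
  also have "\<dots> = metric p (conn X Y p) (Z p) + metric p (Y p) (conn X Z p)"
    using U V W p by (simp add: conn_field field_proj equivariant_frechet_derivative metric_tvec_at)
  finally show "vf_deriv atlas X ?f p = metric p (conn X Y p) (Z p) + metric p (Y p) (conn X Z p)" .
qed

section \<open>The covariant derivative of \<open>J\<close>\<close>

lemma endo_apply_J_field: "endo_apply J (field W) = field (\<lambda>y. J_flat y (W y))"
  by (intro ext) (simp add: endo_apply_def J_def field_def)

lemma equivariant_J_flat: "equivariant W \<Longrightarrow> equivariant (\<lambda>y. J_flat y (W y))"
  by (simp add: equivariant_def)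
    (simp add: J_flat_def act_def B_simps S_linear scaleR_2 algebra_simps)

text \<open>Differentiating \<open>W\<close> inside \<open>J_flat y (W y)\<close> gives the term
  that the covariant derivative subtracts; what remains is the derivative in the base point, on
  which \<open>J_flat\<close> depends affinely with slope \<open>2 B\<close>.\<close>

lemma cov_deriv_J:
  assumes V: "equivariant V" "smooth_on UNIV V" and W: "equivariant W" "smooth_on UNIV W"
  shows "cov_deriv_endo conn J (field V) (field W) = field (\<lambda>y. 2 *\<^sub>R B (V y) (W y))"
proof -
  have dJ: "frechet_derivative (\<lambda>y. J_flat y (W y)) (at y) v =
      J_flat y (frechet_derivative W (at y) v) + 2 *\<^sub>R B v (W y)" for y v
  proof -
    have d: "(W has_derivative frechet_derivative W (at y)) (at y)"
      using W(2) by (rule smooth_on_imp_has_derivative) simp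
    have "((\<lambda>y. J_flat y (W y)) has_derivative (\<lambda>v. S (frechet_derivative W (at y) v)
        + 2 *\<^sub>R (B y (frechet_derivative W (at y) v) + B v (W y)))) (at y)"
      unfolding J_flat_def
      by (intro has_derivative_add has_derivative_scaleR_right B.FDERIV d has_derivative_ident bounded_linear.has_derivative[OF bounded_linear_S])
    from fun_cong[OF frechet_derivative_at[OF this], of v] show ?thesis
      by (simp add: J_flat_def scaleR_add_right add.assoc)
  qed
  show ?thesis
    unfolding cov_deriv_endo_def
    by (simp add: endo_apply_J_field conn_field equivariant_J_flat V W field_diff dJ)
qed

lemma nearly_para_kaehler_quotient: "nearly_para_kaehler quotient atlas metric J conn"
  unfolding nearly_para_kaehler_def
proof (intro conjI allI ballI smooth_manifold_quotient pseudo_riemannian_metric_metric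
    levi_civita_connection_conn endomorphism_field_J)
  fix p u v assume u: "u \<in> tangent_space atlas p" and v: "v \<in> tangent_space atlas p"
  from u show "metric p (J p u) v = - metric p u (J p v)"
  proof (cases rule: tangent_space_cases)
    case (inside y w)
    then obtain w' where "v = tvec_at y w'" using v tangent_space_proj by auto
    with inside show ?thesis by (simp add: J_tvec_at metric_tvec_at G_J_flat)
  next
    case outside
    have "v = 0" using v outside(1) by (elim tangent_space_cases) auto
    with outside show ?thesis by (simp add: J_0 metric_0_0)
  qed
next
  fix p u assume "u \<in> tangent_space atlas p"
  then show "J p (J p u) = u"
    by (simp add: J_def J_flat_J_flat)
next
  fix X assume "X \<in> vector_fields atlas"
  then obtain V where "equivariant V" "smooth_on UNIV V" "X = field V" by (rule vector_fieldsE)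
  then show "cov_deriv_endo conn J X X = 0" by (simp add: cov_deriv_J field_0)
qed

text \<open>These are the fields invariant under the whole group: the vector \<open>w\<close> at 0
  is moved to \<open>y = act y 0\<close> by the differential \<open>1 - B y\<close>. They realise
  any prescribed value at 0.\<close>

lemma equivariant_shear: "equivariant (\<lambda>y. w - B y w)"
  by (simp add: equivariant_def act_def B_simps)

lemma smooth_on_shear: "smooth_on UNIV (\<lambda>y. w - B y w)"
proof -
  have "smooth_on UNIV (\<lambda>y. w + (- B y w))"
    by (intro smooth_on_add smooth_on_const smooth_on_bounded_linear bounded_linear_minus
        B.bounded_linear_left open_UNIV)
  then show ?thesis by simp
qed

lemma cov_deriv_J_nonzero:
  assumes "B v w \<noteq> 0"
  shows "\<exists>X\<in>vector_fields atlas. \<exists>Y\<in>vector_fields atlas. cov_deriv_endo conn J X Y \<noteq> 0"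
proof -
  let ?X = "\<lambda>v. field (\<lambda>y. v - B y v)"
  have X: "?X v \<in> vector_fields atlas" "?X w \<in> vector_fields atlas"
    by (intro field_in_vector_fields equivariant_shear smooth_on_shear)+
  \<comment> \<open>The corrections \<open>B y v\<close> and \<open>B y w\<close> are killed by
    \<open>B\<close>, so the result is constant on the covering.\<close>
  have "cov_deriv_endo conn J (?X v) (?X w) = field (\<lambda>y. 2 *\<^sub>R B v w)"
    by (simp add: cov_deriv_J equivariant_shear smooth_on_shear B_simps)
  moreover have "field (\<lambda>y. 2 *\<^sub>R B v w) \<noteq> 0"
  proof
    assume "field (\<lambda>y. 2 *\<^sub>R B v w) = 0"
    moreover obtain c where "c \<in> atlas" "0 \<in> chart_img c" using chart_around by blast
    ultimately have "2 *\<^sub>R B v w = 0"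
      using field_chart_inv[of c 0 "\<lambda>y. 2 *\<^sub>R B v w"] by simp
    with assms show False by simp
  qed
  ultimately have "cov_deriv_endo conn J (?X v) (?X w) \<noteq> 0" by simp
  with X show ?thesis by blast
qed

end

subsection \<open>The six-dimensional example\<close>

lemma exhaust_6: "(x :: 6) = 1 \<or> x = 2 \<or> x = 3 \<or> x = 4 \<or> x = 5 \<or> x = 6"
proof (induct x)
  case (of_int z)
  then have "z = 0 \<or> z = 1 \<or> z = 2 \<or> z = 3 \<or> z = 4 \<or> z = 5" by fastforce
  then show ?case by auto
qed

lemma forall_6: "(\<forall>i::6. P i) \<longleftrightarrow> P 1 \<and> P 2 \<and> P 3 \<and> P 4 \<and> P 5 \<and> P 6"
  by (metis exhaust_6)

text \<open>
  For \<open>x = (p, q)\<close> with \<open>p, q \<in> \<real>\<^sup>3\<close>, \<open>bracket6 x x' = (q \<times> q', 0)\<close>,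
  \<open>reflection6 x = (p, - q)\<close> and \<open>pairing6 x x' = p \<bullet> q' + q \<bullet> p'\<close>.
\<close>

definition bracket6 :: "real ^ 6 \<Rightarrow> real ^ 6 \<Rightarrow> real ^ 6" where
  "bracket6 x y = (\<chi> i. if i = 1 then x $ 5 * y $ 6 - x $ 6 * y $ 5
     else if i = 2 then x $ 6 * y $ 4 - x $ 4 * y $ 6
     else if i = 3 then x $ 4 * y $ 5 - x $ 5 * y $ 4 else 0)"

definition reflection6 :: "real ^ 6 \<Rightarrow> real ^ 6" where
  "reflection6 x = (\<chi> i. if i = 1 \<or> i = 2 \<or> i = 3 then x $ i else - x $ i)"

definition pairing6 :: "real ^ 6 \<Rightarrow> real ^ 6 \<Rightarrow> real" where
  "pairing6 x y = x $ 1 * y $ 4 + x $ 2 * y $ 5 + x $ 3 * y $ 6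
     + x $ 4 * y $ 1 + x $ 5 * y $ 2 + x $ 6 * y $ 3"

definition lattice6 :: "(real ^ 6) set" where
  "lattice6 = {n. \<forall>i. n $ i \<in> \<int>}"

lemma bilinear_bracket6: "bounded_bilinear bracket6"
  unfolding bilinear_conv_bounded_bilinear[symmetric] bilinear_def
  by (auto intro!: linearI simp: vec_eq_iff forall_6 bracket6_def algebra_simps)

lemma bilinear_pairing6: "bounded_bilinear pairing6"
  unfolding bilinear_conv_bounded_bilinear[symmetric] bilinear_def
  by (auto intro!: linearI simp: pairing6_def algebra_simps)

lemma linear_reflection6: "bounded_linear reflection6"
  unfolding linear_conv_bounded_linear[symmetric]
  by (auto intro!: linearI simp: vec_eq_iff forall_6 reflection6_def)

interpretation six: nil_lattice_para_complex bracket6 lattice6 reflection6 pairing6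
proof (intro nil_lattice_para_complex.intro nil_lattice.intro nil_lattice_para_complex_axioms.intro)
  show "bounded_bilinear bracket6" by (rule bilinear_bracket6)
  show "bounded_bilinear pairing6" by (rule bilinear_pairing6)
  show "bounded_linear reflection6" by (rule linear_reflection6)
  show "\<exists>e>0. \<forall>n\<in>lattice6. norm n < e \<longrightarrow> n = 0"
  proof (intro exI[of _ 1] conjI ballI impI)
    fix n assume n: "n \<in> lattice6" "norm n < 1"
    have "n $ i = 0" for i
      using n component_le_norm_cart[of n i] by (intro Ints_nonzero_abs_less1) (auto simp: lattice6_def)
    then show "n = 0" by (simp add: vec_eq_iff)
  qed simp
  show "x = 0" if *: "\<And>y. pairing6 x y = 0" for x
    using *[of "axis 1 1"] *[of "axis 2 1"] *[of "axis 3 1"] *[of "axis 4 1"] *[of "axis 5 1"] *[of "axis 6 1"]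
    by (simp add: pairing6_def axis_def vec_eq_iff forall_6)
  show "bracket6 m n \<in> lattice6" if "m \<in> lattice6" "n \<in> lattice6" for m n
    using that by (auto simp: lattice6_def bracket6_def)
\<comment> \<open>Among the remaining goals, \<open>G_B_skew\<close> is the antisymmetry of the
  triple product of the second components.\<close>
qed (auto simp: lattice6_def bracket6_def reflection6_def pairing6_def vec_eq_iff forall_6 algebra_simps)

text \<open>The order of reduction matters. Making coordinates 4 to 6 fractional with
  \<open>m\<close> disturbs coordinates 1 to 3 by the real numbers in \<open>bracket6 m y\<close>.
  These are then corrected by \<open>n\<close>, which has no entries in 4 to 6 and so acts as a pure
  translation that leaves the first reduction intact.\<close>

lemma lattice6_cocompact: "\<exists>n\<in>lattice6. six.act n y \<in> cbox 0 (\<chi> i. 1)"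
proof -
  define m :: "real ^ 6" where "m = (\<chi> i. if i = 1 \<or> i = 2 \<or> i = 3 then 0 else - of_int \<lfloor>y $ i\<rfloor>)"
  define z where "z = six.act m y"
  define n :: "real ^ 6" where "n = (\<chi> i. if i = 1 \<or> i = 2 \<or> i = 3 then - of_int \<lfloor>z $ i\<rfloor> else 0)"
  have "z $ i = y $ i - of_int \<lfloor>y $ i\<rfloor>" if "i = 4 \<or> i = 5 \<or> i = 6" for i
    using that by (auto simp: z_def m_def six.act_def bracket6_def)
  moreover have "six.act n z $ i = (if i = 1 \<or> i = 2 \<or> i = 3 then z $ i - of_int \<lfloor>z $ i\<rfloor> else z $ i)" for i
    by (auto simp: n_def six.act_def bracket6_def)
  ultimately have "six.act n z \<in> cbox 0 (\<chi> i. 1)"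
    by (simp add: mem_box_cart forall_6) linarith
  moreover have mn: "m \<in> lattice6" "n \<in> lattice6"
    by (auto simp: lattice6_def m_def n_def)
  have "n + m - bracket6 n m \<in> lattice6"
    using six.L_add[OF six.L_add[OF mn(2,1)] six.L_minus[OF six.L_B[OF mn(2,1)]]] by simp
  ultimately show ?thesis by (metis six.act_act z_def)
qed

theorem mainTheorem18:
  shows "\<exists>(M :: (real^6) set topology) (A :: ((real^6) set, real^6) chart set) g J D.
           nearly_para_kaehler M A g J D \<and> compact_space M \<and> flat A D \<and>
           (\<exists>X\<in>vector_fields A. \<exists>Y\<in>vector_fields A. cov_deriv_endo D J X Y \<noteq> 0)"
proof (intro exI conjI)
  show "nearly_para_kaehler six.quotient six.atlas six.metric six.J six.conn"
    by (rule six.nearly_para_kaehler_quotient)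
  show "compact_space six.quotient"
    using six.compact_space_quotient[OF compact_cbox lattice6_cocompact] .
  show "flat six.atlas six.conn" by (rule six.flat_conn)
  \<comment> \<open>The second components are the first two standard vectors of 3-space, whose cross
    product is the third.\<close>
  have "bracket6 (axis 4 1) (axis 5 1) \<noteq> 0"
    by (simp add: bracket6_def axis_def vec_eq_iff forall_6)
  then show "\<exists>X\<in>vector_fields six.atlas. \<exists>Y\<in>vector_fields six.atlas.
      cov_deriv_endo six.conn six.J X Y \<noteq> 0"
    by (rule six.cov_deriv_J_nonzero)
qed

end
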